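(* Let $N\ge 1$, let $V=\{1,\dots,N,\delta\}$, and let $W_{ij}=W_{ji}>0$ for $i,j\in V$, $i\ne j$, be symmetric positive edge weights. Let $\nu_\delta=\nu_\delta^{W}$ be the effective $t$-field of the $H^{2|2}$ model pinned at $\delta$, i.e. the probability measure on $\mathbb{R}^N$ given by $$d\nu_\delta(\bm t)=e^{-\frac12\sum_{i,j\in V}W_{ij}(\cosh(t_i-t_j)-1)}\sqrt{\mathcal D_W(\bm t)}\prod_{i=1}^N\frac{e^{-t_i}\,dt_i}{\sqrt{2\pi}},\qquad t_\delta=0 .$$ Suppose $F:\mathbb{R}^N\to\mathbb{R}$ is smooth and jointly convex (i.e. it has a positive semi-definite Hessian). Then the integral $$J=\int F(e^{t_1},\dots,e^{t_N})\,d\nu_\delta(\bm t)$$ is non-increasing in each of the edge weights $W_{ij}$ with $i,j\in\{1,\dots,N,\delta\}$, $i\neq j$.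
   Context: Here $\bm t=(t_1,\dots,t_N)$, $t_\delta=0$, and $$\mathcal D_W(\bm t)=\sum_{T\in\mathcal T}\prod_{(ij)\in T}W_{ij}e^{t_i+t_j},$$ where $\mathcal T$ is the set of spanning trees of the complete graph on $V=\{1,\dots,N,\delta\}$ and the product is over the (unoriented) edges of $T$. The sum $\frac12\sum_{i,j\in V}$ runs over ordered pairs, so each unoriented edge is counted once overall (the diagonal terms vanish). It is known that $\nu_\delta$ has total mass $1$ for every choice of positive weights. "Non-increasing in $W_{ij}$" means: with all other edge weights fixed, increasing the weight $W_{ij}=W_{ji}$ does not increase $J$. Convention: the integral $J$ may be non-finite, in which case it evaluates to $+\infty$; the non-increasing property then means that the integral stays $+\infty$ when the edge weights decrease. *)

theory Defs
  imports "HOL-Analysis.Analysis"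
begin

text \<open>
  The vertex set \<open>V = {1, \<dots>, N, \<delta>}\<close> is the type \<open>'n option\<close> for a finite type \<open>'n\<close> with
  \<open>CARD('n) = N\<close>; the pinning point \<open>\<delta>\<close> is \<open>None\<close>.
\<close>

subsection \<open>Spanning trees of a complete graph\<close>

text \<open>Unoriented edges are two-element sets of vertices.\<close>

definition complete_edges :: "'v set set" where
  "complete_edges = {{i, j} | i j. i \<noteq> j}"

definition edges_connected :: "'v set set \<Rightarrow> bool" where
  "edges_connected T \<longleftrightarrow> (\<forall>u v. (u, v) \<in> {(a, b). {a, b} \<in> T}\<^sup>*)"

definition edge_cycle :: "'v set set \<Rightarrow> 'v list \<Rightarrow> bool" where
  "edge_cycle T p \<longleftrightarrow> 3 \<le> length p \<and> distinct p \<and>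
     (\<forall>k < length p. {p ! k, p ! (Suc k mod length p)} \<in> T)"

definition spanning_trees :: "'v set set set" where
  "spanning_trees = {T. T \<subseteq> complete_edges \<and> edges_connected T \<and> (\<nexists>p. edge_cycle T p)}"

text \<open>
  The common value \<open>f i j = f j i\<close> of a symmetric \<open>f\<close> on the unoriented edge \<open>{i, j}\<close>;
  meaningful only for symmetric \<open>f\<close>.
\<close>

definition edge_value :: "('v \<Rightarrow> 'v \<Rightarrow> real) \<Rightarrow> 'v set \<Rightarrow> real" where
  "edge_value f e = (THE x. \<exists>i j. e = {i, j} \<and> x = f i j)"

lemma edge_value_pair:
  assumes "f i j = f j i"
  shows "edge_value f {i, j} = f i j"
  unfolding edge_value_def
  by (rule the_equality) (use assms in \<open>auto simp: doubleton_eq_iff\<close>)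

subsection \<open>The effective field pinned at \<open>\<delta>\<close>\<close>

definition pinned :: "real ^ 'n \<Rightarrow> 'n option \<Rightarrow> real" where
  "pinned t v = (case v of None \<Rightarrow> 0 | Some i \<Rightarrow> t $ i)"

definition tree_sum ::
    "('n::finite option \<Rightarrow> 'n option \<Rightarrow> real) \<Rightarrow> real ^ 'n \<Rightarrow> real" where
  "tree_sum W t =
     (\<Sum>T\<in>spanning_trees. \<Prod>e\<in>T. edge_value (\<lambda>i j. W i j * exp (pinned t i + pinned t j)) e)"

definition t_field_density ::
    "('n::finite option \<Rightarrow> 'n option \<Rightarrow> real) \<Rightarrow> real ^ 'n \<Rightarrow> real" where
  "t_field_density W t =
     exp (- (1 / 2) * (\<Sum>i\<in>UNIV. \<Sum>j\<in>UNIV. W i j * (cosh (pinned t i - pinned t j) - 1)))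
     * sqrt (tree_sum W t)
     * (\<Prod>i\<in>UNIV. exp (- (t $ i)) / sqrt (2 * pi))"

definition t_field ::
    "('n::finite option \<Rightarrow> 'n option \<Rightarrow> real) \<Rightarrow> (real ^ 'n) measure" where
  "t_field W = density lborel (\<lambda>t. ennreal (t_field_density W t))"

text \<open>
  Integral with values in the extended reals, as positive part minus negative part.
  The type \<open>ereal\<close> sets \<open>\<infinity> - \<infinity> = \<infinity>\<close>; for the convex integrands below the negative part
  has finite integral, so this case does not arise.
\<close>

definition extended_integral :: "'a measure \<Rightarrow> ('a \<Rightarrow> real) \<Rightarrow> ereal" where
  "extended_integral M f =
     enn2ereal (\<integral>\<^sup>+ x. ennreal (f x) \<partial>M) - enn2ereal (\<integral>\<^sup>+ x. ennreal (- f x) \<partial>M)"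

definition J_integral ::
    "('n::finite option \<Rightarrow> 'n option \<Rightarrow> real) \<Rightarrow> (real ^ 'n \<Rightarrow> real) \<Rightarrow> ereal" where
  "J_integral W F = extended_integral (t_field W) (\<lambda>t. F (\<chi> i. exp (t $ i)))"

definition set_weight ::
    "('v \<Rightarrow> 'v \<Rightarrow> real) \<Rightarrow> 'v \<Rightarrow> 'v \<Rightarrow> real \<Rightarrow> 'v \<Rightarrow> 'v \<Rightarrow> real" where
  "set_weight W i j w = (\<lambda>a b. if {a, b} = {i, j} then w else W a b)"

subsection \<open>Smooth functions\<close>

primrec times_cont_differentiable ::
    "nat \<Rightarrow> ('a::real_normed_vector \<Rightarrow> 'b::real_normed_vector) \<Rightarrow> bool" where
  "times_cont_differentiable 0 f \<longleftrightarrow> continuous_on UNIV f"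
| "times_cont_differentiable (Suc k) f \<longleftrightarrow>
     (\<forall>x. f differentiable at x) \<and>
     (\<forall>v. times_cont_differentiable k (\<lambda>x. frechet_derivative f (at x) v))"

definition smooth :: "('a::euclidean_space \<Rightarrow> 'b::real_normed_vector) \<Rightarrow> bool" where
  "smooth f \<longleftrightarrow> (\<forall>k. times_cont_differentiable k f)"

end

theory Submission
  imports Defs "HOL-Probability.Distributions"
begin

text \<open>
  Write \<open>x = exp t\<close>. By the matrix-tree theorem the tree sum is a determinant, and a vertex \<open>a\<close> can
  be eliminated by a Schur complement (the star-mesh transformation). In the variable
  \<open>s = t\<^sub>a - ln (\<Sum>\<^sub>v W\<^sub>a\<^sub>v x\<^sub>v)\<close>, a mere translation of \<open>t\<^sub>a\<close>, the density factors into a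
  probability density in \<open>s\<close> that only involves the weights at \<open>a\<close>, and the density of the field
  on the remaining vertices with weights \<open>W\<^sub>u\<^sub>v + exp s * W\<^sub>a\<^sub>u * W\<^sub>a\<^sub>v\<close>. Given \<open>s\<close>, the eliminated
  \<open>x\<^sub>a\<close> is an affine function of the remaining coordinates, so convexity of the integrand survives.

  For an edge \<open>{k, \<delta>}\<close>, eliminating all vertices but \<open>k\<close> leaves an inverse Gaussian law of mean \<open>1\<close>
  whose shape is the edge weight plus a constant; these laws decrease in the convex order since two
  of their densities cross exactly twice. For an edge \<open>{p, q}\<close> eliminate all vertices but \<open>p\<close> and
  \<open>q\<close> and move the pin to \<open>p\<close>; this replaces the integrand by its perspective, which is again convex.
  Subtracting an affine minorant, whose integral does not depend on the weights because the field
  has mass and means \<open>1\<close>, reduces the theorem to nonnegative integrands.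
\<close>

section \<open>Spanning trees and the Laplacian determinant\<close>

text \<open>A spanning tree oriented towards the pin is encoded by its parent map. A rank that drops
  from each vertex to its parent certifies that every chain of parents ends at \<open>None\<close>,
  and it later serves as an induction measure.\<close>

definition parent_rank :: "('n \<Rightarrow> 'n option) \<Rightarrow> ('n option \<Rightarrow> nat) \<Rightarrow> bool" where
  "parent_rank f d \<longleftrightarrow> (\<forall>i. d (f i) < d (Some i))"

definition rooted :: "('n \<Rightarrow> 'n option) \<Rightarrow> bool" where
  "rooted f \<longleftrightarrow> (\<exists>d. parent_rank f d)"

definition parent_edges :: "('n \<Rightarrow> 'n option) \<Rightarrow> 'n option set set" where
  "parent_edges f = range (\<lambda>i. {Some i, f i})"

lemma parent_edges_iff:
  "{u, v} \<in> parent_edges f \<longleftrightarrow> (\<exists>i. u = Some i \<and> v = f i \<or> v = Some i \<and> u = f i)"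
  by (auto simp: parent_edges_def doubleton_eq_iff)

text \<open>The least number of steps to \<open>None\<close> is a valid rank.\<close>

lemma rooted_if_all_reach:
  assumes "\<And>i. (Some i, None) \<in> {(Some i, f i) |i. True}\<^sup>*"
  shows "rooted f"
proof -
  define R where "R = {(Some i, f i) |i. True}"
  define d where "d v = (LEAST n. (v, None) \<in> R ^^ n)" for v
  have "d (f i) < d (Some i)" for i
  proof -
    have "\<exists>n. (Some i, None) \<in> R ^^ n"
      using assms[of i] unfolding R_def[symmetric] by (simp add: rtrancl_power)
    then have *: "(Some i, None) \<in> R ^^ d (Some i)"
      unfolding d_def by (rule LeastI_ex)
    then obtain m where m: "d (Some i) = Suc m"
      by (cases "d (Some i)") simp_all
    with * obtain y where "(Some i, y) \<in> R" "(y, None) \<in> R ^^ m"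
      by (metis relpow_Suc_D2)
    then have "(f i, None) \<in> R ^^ m" by (auto simp: R_def)
    then have "d (f i) \<le> m" unfolding d_def by (rule Least_le)
    with m show ?thesis by simp
  qed
  then show ?thesis by (auto simp: rooted_def parent_rank_def)
qed

text \<open>Adding row \<open>f i\<close> to row \<open>i\<close> replaces the parent of \<open>i\<close> by its grandparent.\<close>

lemma det_parent_rooted:
  fixes f :: "'n::finite \<Rightarrow> 'n option"
  assumes "rooted f"
  shows "det (\<chi> i j. (if j = i then 1 else 0) - (if Some j = f i then 1 else (0::real))) = 1"
proof -
  from assms obtain d where "parent_rank f d" by (auto simp: rooted_def)
  then show ?thesis
  \<comment> \<open>For fixed \<open>d\<close> the total rank of the parents drops with every such
    row operation. The process ends when all parents are \<open>None\<close>, where the matrix is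
    the identity.\<close>
  proof (induction "\<Sum>i\<in>UNIV. d (f i)" arbitrary: f rule: less_induct)
    case less
    show ?case
    proof (cases "\<forall>i. f i = None")
      case True
      then have "(\<chi> i j. (if j = i then 1 else 0) - (if Some j = f i then 1 else (0::real))) = mat 1"
        by (auto simp: vec_eq_iff mat_def)
      then show ?thesis by simp
    next
      case False
      then obtain i j where ij: "f i = Some j" by auto
      define g where "g = f(i := f j)"
      have dj: "d (f j) < d (Some j)" and di: "d (f i) < d (Some i)"
        using less.prems by (auto simp: parent_rank_def)
      have ne: "i \<noteq> j" using di ij by auto
      have "d (f j) < d (Some i)" using dj di ij by simp
      then have "parent_rank g d" using less.prems
        by (auto simp: parent_rank_def g_def)
      moreover have "(\<Sum>i\<in>UNIV. d (g i)) < (\<Sum>i\<in>UNIV. d (f i))"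
      proof (rule sum_strict_mono_ex1)
        show "\<forall>l\<in>UNIV. d (g l) \<le> d (f l)" using dj ij by (simp add: g_def)
        show "\<exists>l\<in>UNIV. d (g l) < d (f l)" using dj ij by (intro bexI[of _ i]) (simp_all add: g_def)
      qed simp
      ultimately have 1: "det (\<chi> i j. (if j = i then 1 else 0) - (if Some j = g i then 1 else (0::real))) = 1"
        using less.hyps by blast
      let ?M = "\<chi> i j. (if j = i then 1 else 0) - (if Some j = f i then 1 else (0::real))"
      have "(\<chi> i j. (if j = i then 1 else 0) - (if Some j = g i then 1 else (0::real)))
         = (\<chi> k. if k = i then row i ?M + 1 *s row j ?M else row k ?M)"
        using ij ne by (auto simp: vec_eq_iff g_def row_def)
      then have "det (\<chi> i j. (if j = i then 1 else 0) - (if Some j = g i then 1 else (0::real))) = det ?M"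
        using det_row_operation[OF ne, of ?M 1] by simp
      with 1 show ?thesis by simp
    qed
  qed
qed

text \<open>The indicator of the vertices that never reach the root lies in the kernel.\<close>

lemma det_parent_not_rooted:
  fixes f :: "'n::finite \<Rightarrow> 'n option"
  assumes "\<not> rooted f"
  shows "det (\<chi> i j. (if j = i then 1 else 0) - (if Some j = f i then 1 else (0::real))) = 0"
proof -
  define R where "R = {(Some i, f i) |i. True}"
  let ?M = "\<chi> i j. (if j = i then 1 else 0) - (if Some j = f i then 1 else (0::real))"
  define U where "U = {i. (Some i, None) \<notin> R\<^sup>*}"
  obtain i0 where i0: "i0 \<in> U"
    using assms rooted_if_all_reach[of f] by (auto simp: U_def R_def)
  define x :: "real^'n" where "x = (\<chi> i. if i \<in> U then 1 else 0)"
  have step: "(Some i, None) \<in> R\<^sup>* \<longleftrightarrow> (f i, None) \<in> R\<^sup>*" for i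
  proof
    assume "(Some i, None) \<in> R\<^sup>*"
    then obtain y where "(Some i, y) \<in> R" "(y, None) \<in> R\<^sup>*"
      by (rule converse_rtranclE) simp
    then show "(f i, None) \<in> R\<^sup>*" by (simp add: R_def)
  next
    assume "(f i, None) \<in> R\<^sup>*"
    moreover have "(Some i, f i) \<in> R" by (simp add: R_def)
    ultimately show "(Some i, None) \<in> R\<^sup>*"
      by (rule converse_rtrancl_into_rtrancl[rotated])
  qed
  have "?M *v x = 0"
  proof (rule vec_eq_iff[THEN iffD2], rule)
    fix i
    have "(?M *v x) $ i = (\<Sum>j\<in>UNIV. (if j = i then x $ j else 0) - (if Some j = f i then x $ j else 0))"
      by (auto simp: matrix_vector_mult_def intro!: sum.cong)
    also have "\<dots> = x $ i - (\<Sum>j\<in>UNIV. if Some j = f i then x $ j else 0)"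
      by (simp add: sum_subtractf)
    also have "(\<Sum>j\<in>UNIV. if Some j = f i then x $ j else 0) = x $ i"
    proof (cases "f i")
      case None
      then have "i \<notin> U" using step[of i] by (auto simp: U_def)
      with None show ?thesis by (simp add: x_def)
    next
      case (Some j)
      then have "i \<in> U \<longleftrightarrow> j \<in> U" using step[of i] by (auto simp: U_def)
      with Some show ?thesis by (simp add: x_def)
    qed
    finally show "(?M *v x) $ i = 0 $ i" by simp
  qed
  moreover have "x \<noteq> 0" using i0 by (auto simp: x_def vec_eq_iff)
  ultimately have "\<not> (\<forall>x. ?M *v x = 0 \<longrightarrow> x = 0)" by blast
  then have "\<not> invertible ?M"
    unfolding invertible_left_inverse matrix_left_invertible_ker .
  then show ?thesis unfolding invertible_det_nz by simp
qed

section \<open>Expansion of the Laplacian determinant over parent maps\<close>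

lemma det_rows_sum_aux:
  fixes a :: "'n::finite \<Rightarrow> 'v::finite \<Rightarrow> real^'n"
  assumes "finite U"
  shows "det (\<chi> i. if i \<in> U then \<Sum>v\<in>UNIV. a i v else c i) =
    (\<Sum>f\<in>U \<rightarrow>\<^sub>E UNIV. det (\<chi> i. if i \<in> U then a i (f i) else c i))"
  using assms
proof (induction U arbitrary: c)
  case (insert k U)
  have "det (\<chi> i. if i \<in> insert k U then \<Sum>v\<in>UNIV. a i v else c i) =
      det (\<chi> i. if i = k then \<Sum>v\<in>UNIV. a k v else if i \<in> U then \<Sum>v\<in>UNIV. a i v else c i)"
    by (intro arg_cong[of _ _ det]) (auto simp: vec_eq_iff)
  also have "\<dots> = (\<Sum>v\<in>UNIV. det (\<chi> i. if i = k then a k v else if i \<in> U then \<Sum>v\<in>UNIV. a i v else c i))"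
    by (rule det_linear_row_sum) simp
  also have "\<dots> = (\<Sum>v\<in>UNIV. det (\<chi> i. if i \<in> U then \<Sum>v\<in>UNIV. a i v else (c(k := a k v)) i))"
    using insert.hyps by (intro sum.cong refl arg_cong[of _ _ det]) (auto simp: vec_eq_iff)
  also have "\<dots> = (\<Sum>(v, f)\<in>UNIV \<times> (U \<rightarrow>\<^sub>E UNIV). det (\<chi> i. if i \<in> U then a i (f i) else (c(k := a k v)) i))"
    by (simp only: insert.IH sum.cartesian_product)
  also have "\<dots> = (\<Sum>(v, f)\<in>UNIV \<times> (U \<rightarrow>\<^sub>E UNIV). det (\<chi> i. if i \<in> insert k U then a i ((f(k := v)) i) else c i))"
    using insert.hyps
    by (intro sum.cong refl) (auto intro!: arg_cong[of _ _ det] simp: vec_eq_iff)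
  also have "\<dots> = (\<Sum>f\<in>insert k U \<rightarrow>\<^sub>E UNIV. det (\<chi> i. if i \<in> insert k U then a i (f i) else c i))"
    unfolding PiE_insert_eq
    using insert.hyps
    by (subst sum.reindex[OF inj_combinator]) (auto simp: o_def case_prod_unfold)
  finally show ?case .
qed simp

lemma det_rows_sum:
  fixes a :: "'n::finite \<Rightarrow> 'v::finite \<Rightarrow> real^'n"
  shows "det (\<chi> i. \<Sum>v\<in>UNIV. a i v) = (\<Sum>f\<in>UNIV. det (\<chi> i. a i (f i)))"
  using det_rows_sum_aux[of UNIV a] by simp

text \<open>The weighted Laplacian of the complete graph with the row and column of the pin deleted;
  edges to the pin survive on the diagonal only.\<close>

definition laplacian :: "('n::finite option \<Rightarrow> 'n option \<Rightarrow> real) \<Rightarrow> real^'n^'n" where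
  "laplacian c = (\<chi> i j. if i = j then \<Sum>v\<in>UNIV - {Some i}. c (Some i) v else - c (Some i) (Some j))"

text \<open>Row \<open>i\<close> is the sum, over all candidate parents \<open>v\<close>, of
  \<open>c (Some i) v\<close> times \<open>e_i - e_v\<close>, where \<open>e_None = 0\<close>.
  Multilinearity turns the determinant into a sum over all parent maps, in which the rooted ones
  have determinant 1 and the others 0.\<close>

lemma det_laplacian_rooted:
  "det (laplacian c) = (\<Sum>f | rooted f. \<Prod>i\<in>UNIV. c (Some i) (f i))"
proof -
  let ?r = "\<lambda>i v. (\<chi> j. (if j = i then 1 else 0) - (if Some j = v then 1 else (0::real)))"
  have "laplacian c = (\<chi> i. \<Sum>v\<in>UNIV. c (Some i) v *s ?r i v)"
  proof -
    have "laplacian c $ i $ j = (\<chi> i. \<Sum>v\<in>UNIV. c (Some i) v *s ?r i v) $ i $ j" for i j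
    proof -
      have "(\<Sum>v\<in>UNIV. c (Some i) v * ((if j = i then 1 else 0) - (if Some j = v then 1 else 0))) =
        (\<Sum>v\<in>UNIV. if j = i then c (Some i) v else 0) - (\<Sum>v\<in>UNIV. if Some j = v then c (Some i) v else 0)"
        unfolding sum_subtractf[symmetric] by (intro sum.cong) auto
      also have "\<dots> = (if j = i then \<Sum>v\<in>UNIV. c (Some i) v else 0) - c (Some i) (Some j)"
        by auto
      also have "\<dots> = laplacian c $ i $ j"
        by (simp add: laplacian_def sum_diff1)
      finally show ?thesis by simp
    qed
    then show ?thesis by (simp only: vec_eq_iff simp_thms)
  qed
  then have "det (laplacian c) = (\<Sum>f\<in>UNIV. det (\<chi> i. c (Some i) (f i) *s ?r i (f i)))"
    by (simp only: det_rows_sum)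
  also have "\<dots> = (\<Sum>f\<in>UNIV. (\<Prod>i\<in>UNIV. c (Some i) (f i)) * det (\<chi> i. ?r i (f i)))"
    by (simp only: det_rows_mul)
  also have "\<dots> = (\<Sum>f\<in>UNIV. if rooted f then \<Prod>i\<in>UNIV. c (Some i) (f i) else 0)"
    by (intro sum.cong refl) (simp add: det_parent_rooted det_parent_not_rooted)
  finally show ?thesis by (simp add: sum.If_cases)
qed

section \<open>Spanning trees as rooted parent maps\<close>

lemma simple_path_exists:
  assumes "(u, v) \<in> R\<^sup>*"
  shows "\<exists>p. p \<noteq> [] \<and> hd p = u \<and> last p = v \<and> distinct p \<and> successively (\<lambda>a b. (a, b) \<in> R) p"
  using assms
proof (induction rule: converse_rtrancl_induct)
  case base
  show ?case by (rule exI[of _ "[v]"]) simp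
next
  case (step u y)
  then obtain p where p: "p \<noteq> []" "hd p = y" "last p = v" "distinct p"
    "successively (\<lambda>a b. (a, b) \<in> R) p" by blast
  show ?case
  proof (cases "u \<in> set p")
    case True
    then obtain p1 p2 where "p = p1 @ u # p2" by (auto simp: in_set_conv_decomp)
    with p show ?thesis
      by (intro exI[of _ "u # p2"]) (auto simp: successively_append_iff)
  next
    case False
    with p step(1) show ?thesis
      by (intro exI[of _ "u # p"]) (auto simp: successively_Cons)
  qed
qed

text \<open>Following parents connects every vertex to \<open>None\<close>. On a cycle, a vertex of
  maximal rank would have two distinct neighbours, and both would have to be its parent.\<close>

lemma parent_edges_spanning_tree:
  assumes "rooted f"
  shows "parent_edges f \<in> spanning_trees"
proof -
  from assms obtain d :: "_ \<Rightarrow> nat" where d: "\<And>i. d (f i) < d (Some i)"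
    by (auto simp: rooted_def parent_rank_def)
  let ?E = "{(a, b). {a, b} \<in> parent_edges f}"
  have "parent_edges f \<subseteq> complete_edges"
  proof
    fix e assume "e \<in> parent_edges f"
    then obtain i where "e = {Some i, f i}" by (auto simp: parent_edges_def)
    moreover have "Some i \<noteq> f i" using d[of i] by auto
    ultimately show "e \<in> complete_edges" by (auto simp: complete_edges_def)
  qed
  moreover have "edges_connected (parent_edges f)"
  proof -
    have reach: "(v, None) \<in> ?E\<^sup>*" for v
    proof (induction "d v" arbitrary: v rule: less_induct)
      case less
      show ?case
      proof (cases v)
        case (Some i)
        have "(Some i, f i) \<in> ?E" by (auto simp: parent_edges_iff)
        moreover have "(f i, None) \<in> ?E\<^sup>*" using less d Some by blast
        ultimately show ?thesis using Some by (simp add: converse_rtrancl_into_rtrancl)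
      qed auto
    qed
    have "sym ?E" by (auto simp: sym_def insert_commute)
    then have "sym (?E\<^sup>*)" by (rule sym_rtrancl)
    then show ?thesis unfolding edges_connected_def using reach
      by (meson rtrancl_trans symE)
  qed
  moreover have "\<not> edge_cycle (parent_edges f) p" for p
  proof
    assume "edge_cycle (parent_edges f) p"
    then have len: "3 \<le> length p" and dist: "distinct p"
      and E: "\<And>k. k < length p \<Longrightarrow> {p ! k, p ! (Suc k mod length p)} \<in> parent_edges f"
      by (auto simp: edge_cycle_def)
    have "finite ((\<lambda>k. d (p ! k)) ` {..<length p})" "(\<lambda>k. d (p ! k)) ` {..<length p} \<noteq> {}"
      using len by (auto simp: lessThan_empty_iff)
    from Max_in[OF this] obtain k where k: "k < length p"
      and "d (p ! k) = Max ((\<lambda>k. d (p ! k)) ` {..<length p})" by auto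
    then have max: "d (p ! l) \<le> d (p ! k)" if "l < length p" for l
      using that by simp
    have nb: "\<exists>i. p ! k = Some i \<and> p ! l = f i"
      if "l < length p" "{p ! k, p ! l} \<in> parent_edges f" for l
    proof -
      from that(2) obtain i where "p ! k = Some i \<and> p ! l = f i \<or> p ! l = Some i \<and> p ! k = f i"
        unfolding parent_edges_iff by blast
      moreover have "\<not> (p ! l = Some i \<and> p ! k = f i)" using max[OF that(1)] d[of i] by auto
      ultimately show ?thesis by blast
    qed
    \<comment> \<open>\<open>l\<close> and \<open>m\<close> are the cyclic successor and predecessor
      of \<open>k\<close>, the predecessor of 0 being the last index. They differ because the cycle
      has length at least 3.\<close>
    define l where "l = Suc k mod length p"
    define m where "m = (if k = 0 then length p - 1 else k - 1)"
    have pos: "0 < length p" using len by linarith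
    have l: "l < length p" "{p ! k, p ! l} \<in> parent_edges f"
      using E[OF k] pos by (simp_all add: l_def)
    have sm: "Suc m mod length p = k"
      using k pos by (cases k) (simp_all add: m_def)
    have m: "m < length p" using k pos by (auto simp: m_def)
    then have m': "{p ! k, p ! m} \<in> parent_edges f"
      using E[OF m] by (simp add: sm insert_commute)
    have "l \<noteq> m"
    proof (cases "Suc k = length p")
      case True
      then have "l = 0" "m = k - 1" "k \<ge> 2" using len by (auto simp: l_def m_def)
      then show ?thesis by linarith
    next
      case False
      then have "l = Suc k" using k by (simp add: l_def)
      then show ?thesis using False len by (auto simp: m_def)
    qed
    then have "p ! l \<noteq> p ! m" using dist l m by (simp add: nth_eq_iff_index_eq)
    then show False using nb[OF l] nb[OF m m'] by auto
  qed
  ultimately show ?thesis by (auto simp: spanning_trees_def)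
qed

text \<open>With equal edge sets, \<open>f\<close> and \<open>g\<close> can differ at
  \<open>i\<close> only if \<open>g\<close> runs backwards along an edge of \<open>f\<close> there.
  It would then run backwards again at the parent \<open>g i\<close>, whose rank is smaller, so
  infinite descent excludes this.\<close>

lemma parent_edges_inj: "inj_on parent_edges {f. rooted f}"
proof (rule inj_onI, simp)
  fix f g :: "'n \<Rightarrow> 'n option"
  assume "rooted f" "rooted g" and eq: "parent_edges f = parent_edges g"
  then obtain d :: "_ \<Rightarrow> nat" where d: "\<And>i. d (g i) < d (Some i)"
    by (auto simp: rooted_def parent_rank_def)
  have adj: "g i = f i \<or> (\<exists>j. g i = Some j \<and> f j = Some i)" for i
  proof -
    have "{Some i, g i} \<in> parent_edges f" unfolding eq by (auto simp: parent_edges_def)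
    then show ?thesis by (auto simp: parent_edges_iff)
  qed
  have no_flip: "\<not> (\<exists>j. g i = Some j \<and> f j = Some i)" for i
  proof (induction "d (Some i)" arbitrary: i rule: less_induct)
    case less
    show ?case
    proof
      assume "\<exists>j. g i = Some j \<and> f j = Some i"
      then obtain j where j: "g i = Some j" "f j = Some i" by blast
      have lt: "d (Some j) < d (Some i)" using d[of i] j by simp
      have "g j \<noteq> Some i" using d[of j] lt by auto
      with adj[of j] j less[OF lt] show False by auto
    qed
  qed
  show "f = g" using adj no_flip by (auto simp: fun_eq_iff)
qed

text \<open>The parent of a vertex is chosen as a neighbour closer to \<open>None\<close> in graph
  distance. The parent edges already connect all vertices, so a further edge of \<open>T\<close>
  would close a simple path of parent edges to a cycle.\<close>

lemma spanning_tree_parent_edges: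
  fixes T :: "'n option set set"
  assumes "T \<in> spanning_trees"
  shows "\<exists>f. rooted f \<and> T = parent_edges f"
proof -
  let ?E = "{(a, b). {a, b} \<in> T}"
  have sub: "T \<subseteq> complete_edges" and conn: "\<And>u v. (u, v) \<in> ?E\<^sup>*" and acyc: "\<And>p. \<not> edge_cycle T p"
    using assms by (auto simp: spanning_trees_def edges_connected_def)
  define d where "d v = (LEAST n. (v, None) \<in> ?E ^^ n)" for v
  have "\<exists>w. {Some i, w} \<in> T \<and> d w < d (Some i)" for i
  proof -
    have "\<exists>n. (Some i, None) \<in> ?E ^^ n"
      using conn by (simp add: rtrancl_power)
    then have *: "(Some i, None) \<in> ?E ^^ d (Some i)"
      unfolding d_def by (rule LeastI_ex)
    then obtain m where m: "d (Some i) = Suc m"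
      by (cases "d (Some i)") auto
    with * obtain y where y: "(Some i, y) \<in> ?E" "(y, None) \<in> ?E ^^ m"
      by (metis relpow_Suc_D2)
    then have "d y \<le> m" unfolding d_def by (intro Least_le)
    with m y show ?thesis by auto
  qed
  then obtain f where f: "\<And>i. {Some i, f i} \<in> T" "\<And>i. d (f i) < d (Some i)" by metis
  then have r: "rooted f" by (auto simp: rooted_def parent_rank_def)
  have le: "parent_edges f \<subseteq> T" using f by (auto simp: parent_edges_def)
  have "T \<subseteq> parent_edges f"
  proof
    fix e assume e: "e \<in> T"
    then obtain u v where uv: "e = {u, v}" "u \<noteq> v" using sub by (auto simp: complete_edges_def)
    show "e \<in> parent_edges f"
    proof (rule ccontr)
      assume ne: "e \<notin> parent_edges f"
      have "(u, v) \<in> {(a, b). {a, b} \<in> parent_edges f}\<^sup>*"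
        using parent_edges_spanning_tree[OF r] by (auto simp: spanning_trees_def edges_connected_def)
      from simple_path_exists[OF this] obtain p where p: "p \<noteq> []" "hd p = u" "last p = v" "distinct p"
        "successively (\<lambda>a b. {a, b} \<in> parent_edges f) p" by auto
      have step: "{p ! k, p ! Suc k} \<in> parent_edges f" if "Suc k < length p" for k
        using p(5) that by (simp add: successively_conv_nth)
      have hl: "p ! 0 = u" "p ! (length p - 1) = v"
        using p by (auto simp: hd_conv_nth last_conv_nth)
      have "length p \<noteq> 0" "length p \<noteq> 1" "length p \<noteq> 2"
        using p(1) hl uv step[of 0] ne by auto
      then have len: "3 \<le> length p" by linarith
      have "{p ! k, p ! (Suc k mod length p)} \<in> T" if "k < length p" for k
      proof (cases "Suc k = length p")
        case True
        then have "k = length p - 1" by simp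
        then have "p ! k = v" "p ! (Suc k mod length p) = u" using hl True by auto
        then show ?thesis using e uv by (simp add: insert_commute)
      next
        case False
        then show ?thesis using step[of k] that le by auto
      qed
      with len p have "edge_cycle T p" by (auto simp: edge_cycle_def)
      with acyc show False by blast
    qed
  qed
  with le r show ?thesis by auto
qed

text \<open>The matrix-tree theorem. Ranks make \<open>i \<mapsto> {Some i, f i}\<close> injective,
  so the product over the edges of a tree is the product over vertices found in the determinant
  expansion.\<close>

lemma tree_sum_eq_det:
  assumes sym: "\<And>i j. W i j = W j i"
  shows "tree_sum W t = det (laplacian (\<lambda>i j. W i j * exp (pinned t i + pinned t j)))"
proof -
  let ?c = "\<lambda>i j. W i j * exp (pinned t i + pinned t j)"
  have csym: "?c i j = ?c j i" for i j using sym[of i j] by (simp add: add.commute)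
  have trees: "spanning_trees = parent_edges ` {f. rooted f}"
    using spanning_tree_parent_edges parent_edges_spanning_tree by auto
  have "(\<Prod>e\<in>parent_edges f. edge_value ?c e) = (\<Prod>i\<in>UNIV. ?c (Some i) (f i))"
    if "rooted f" for f
  proof -
    from that obtain d :: "_ \<Rightarrow> nat" where d: "\<And>i. d (f i) < d (Some i)"
      by (auto simp: rooted_def parent_rank_def)
    have "inj (\<lambda>i. {Some i, f i})"
    proof (rule injI)
      fix i j assume "{Some i, f i} = {Some j, f j}"
      then show "i = j" using d[of i] d[of j] by (auto simp: doubleton_eq_iff)
    qed
    then show ?thesis unfolding parent_edges_def
      by (simp add: prod.reindex edge_value_pair[of ?c, OF csym])
  qed
  then show ?thesis
    unfolding tree_sum_def trees det_laplacian_rooted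
    by (simp add: sum.reindex[OF parent_edges_inj])
qed

section \<open>Star-mesh transformation\<close>

definition pin_set :: "'n set \<Rightarrow> 'n option set" where
  "pin_set A = insert None (Some ` A)"

definition pin_ext :: "('n \<Rightarrow> real) \<Rightarrow> 'n option \<Rightarrow> real" where
  "pin_ext x v = (case v of None \<Rightarrow> 1 | Some i \<Rightarrow> x i)"

lemma pin_ext_simps [simp]: "pin_ext x None = 1" "pin_ext x (Some i) = x i"
  by (simp_all add: pin_ext_def)

lemma pin_set_simps [simp]:
  "None \<in> pin_set A" "Some i \<in> pin_set A \<longleftrightarrow> i \<in> A"
  "pin_set (insert a A) = insert (Some a) (pin_set A)" "pin_set {} = {None}"
  by (auto simp: pin_set_def)

lemma finite_pin_set [simp]: "finite (pin_set (A :: 'n::finite set))"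
  by (simp add: pin_set_def)

lemma pin_ext_pos: "(\<And>i. 0 < x i) \<Longrightarrow> 0 < pin_ext x v"
  by (cases v) auto

text \<open>
  Only the block \<open>A \<times> A\<close> matters; the identity on the complement keeps the determinant that of
  the block, so that vertices can be removed without changing the index type.
\<close>

definition sub_laplacian ::
    "'n::finite set \<Rightarrow> ('n option \<Rightarrow> 'n option \<Rightarrow> real) \<Rightarrow> ('n \<Rightarrow> real) \<Rightarrow> real^'n^'n" where
  "sub_laplacian A W x = (\<chi> i j. if i \<in> A \<and> j \<in> A then
       (if i = j then x i * (\<Sum>v\<in>pin_set A - {Some i}. W (Some i) v * pin_ext x v)
        else - W (Some i) (Some j) * x i * x j)
     else if i = j then 1 else 0)"

text \<open>For symmetric \<open>W\<close> this is the sum of \<open>W u v * (cosh (t u - t v) - 1)\<close> with \<open>x = exp t\<close>.\<close>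

definition energy ::
    "'n::finite set \<Rightarrow> ('n option \<Rightarrow> 'n option \<Rightarrow> real) \<Rightarrow> ('n \<Rightarrow> real) \<Rightarrow> real" where
  "energy A W x = 1 / 2 * (\<Sum>u\<in>pin_set A. \<Sum>v\<in>pin_set A. W u v * (pin_ext x u / pin_ext x v - 1))"

definition weight ::
    "'n::finite set \<Rightarrow> ('n option \<Rightarrow> 'n option \<Rightarrow> real) \<Rightarrow> ('n \<Rightarrow> real) \<Rightarrow> real" where
  "weight A W x = exp (- energy A W x) * sqrt (det (sub_laplacian A W x))
     * (\<Prod>i\<in>A. 1 / (x i * sqrt (2 * pi)))"

text \<open>Removing \<open>a\<close> creates an additional conductance between each pair of its
  neighbours. The diagonal values change as well, but the Laplacian omits them and they cancel in
  the energy at positive points.\<close>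

definition star_mesh ::
    "('v option \<Rightarrow> 'v option \<Rightarrow> real) \<Rightarrow> 'v \<Rightarrow> real \<Rightarrow> 'v option \<Rightarrow> 'v option \<Rightarrow> real" where
  "star_mesh W a r u v = W u v + r * W (Some a) u * W (Some a) v"

definition star_sum ::
    "'n::finite set \<Rightarrow> ('n option \<Rightarrow> 'n option \<Rightarrow> real) \<Rightarrow> 'n \<Rightarrow> ('n \<Rightarrow> real) \<Rightarrow> real" where
  "star_sum B W a x = (\<Sum>v\<in>pin_set B. W (Some a) v * pin_ext x v)"

text \<open>
  The factor that the weight sheds when \<open>x a\<close> is replaced by \<open>r = x a / star_sum B W a x\<close>; here
  \<open>M\<close> is the total weight at \<open>a\<close>. With \<open>r = 1 / (2 \<beta>)\<close> this is, in the variable \<open>ln r\<close>, the law of the random potential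
  \<open>\<beta>\<close> at \<open>a\<close>.
\<close>

definition eliminated_density :: "real \<Rightarrow> real \<Rightarrow> real" where
  "eliminated_density M r = exp (- (r * M\<^sup>2 / 2 - M + 1 / (2 * r))) / (sqrt r * sqrt (2 * pi))"

definition symmetric_weights :: "'n set \<Rightarrow> ('n option \<Rightarrow> 'n option \<Rightarrow> real) \<Rightarrow> bool" where
  "symmetric_weights A W \<longleftrightarrow> (\<forall>u\<in>pin_set A. \<forall>v\<in>pin_set A. W u v = W v u)"

lemma symmetric_weightsD: "symmetric_weights A W \<Longrightarrow> u \<in> pin_set A \<Longrightarrow> v \<in> pin_set A \<Longrightarrow> W u v = W v u"
  unfolding symmetric_weights_def by blast

text \<open>Symmetric Gaussian elimination with the pivot \<open>x a * star_sum B W a x\<close>. The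
  matrix factors as \<open>P ** Q ** transpose P\<close>, where \<open>P\<close> is the identity
  plus the multipliers \<open>n\<close> in column \<open>a\<close>, and \<open>Q\<close> holds the
  pivot and, on \<open>B\<close>, the Schur complement. The relation between \<open>x a\<close> and
  \<open>r\<close> makes this complement the star-mesh Laplacian.\<close>

lemma det_star_mesh:
  fixes W :: "'n::finite option \<Rightarrow> 'n option \<Rightarrow> real"
  assumes aB: "a \<notin> B" and sym: "symmetric_weights (insert a B) W"
    and S: "star_sum B W a x \<noteq> 0" and xa: "x a = r * star_sum B W a x"
  shows "det (sub_laplacian (insert a B) W x)
    = x a * star_sum B W a x * det (sub_laplacian B (star_mesh W a r) x)"
proof -
  let ?S = "star_sum B W a x"
  let ?L = "sub_laplacian (insert a B) W x"
  let ?N = "sub_laplacian B (star_mesh W a r) x"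
  define n where "n i = (if i \<in> B then - W (Some i) (Some a) * x i / ?S else 0)" for i
  define P :: "real^'n^'n" where "P = (\<chi> i j. (if i = j then 1 else 0) + (if j = a then n i else 0))"
  define Q :: "real^'n^'n" where "Q = (\<chi> i. if i = a then (x a * ?S) *s ?N $ i else ?N $ i)"
  have W_sym: "W u v = W v u" if "u \<in> pin_set (insert a B)" "v \<in> pin_set (insert a B)" for u v
    using sym that by (rule symmetric_weightsD)
  have entry: "(P ** Q ** transpose P) $ i $ j
      = Q $ i $ j + n i * Q $ a $ j + n j * (Q $ i $ a + n i * Q $ a $ a)" for i j
  proof -
    have 1: "(P ** Q) $ i $ j = Q $ i $ j + n i * Q $ a $ j" for i j
    proof -
      have "(P ** Q) $ i $ j = (\<Sum>k\<in>UNIV. (if i = k then Q $ k $ j else 0) + (if k = a then n i * Q $ k $ j else 0))"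
        by (auto simp: matrix_matrix_mult_def P_def algebra_simps intro!: sum.cong)
      then show ?thesis by (simp add: sum.distrib)
    qed
    have "(P ** Q ** transpose P) $ i $ j
        = (\<Sum>k\<in>UNIV. (if j = k then (P ** Q) $ i $ k else 0) + (if k = a then n j * (P ** Q) $ i $ k else 0))"
      by (subst matrix_matrix_mult_def) (auto simp: transpose_def P_def algebra_simps intro!: sum.cong)
    then show ?thesis by (simp add: sum.distrib 1)
  qed
  have diag: "x i * (\<Sum>v\<in>pin_set (insert a B) - {Some i}. W (Some i) v * pin_ext x v)
      = x i * (\<Sum>v\<in>pin_set B - {Some i}. star_mesh W a r (Some i) v * pin_ext x v) + n i * n i * (x a * ?S)"
    if i: "i \<in> B" for i
  proof -
    let ?T = "\<Sum>v\<in>pin_set B - {Some i}. W (Some i) v * pin_ext x v"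
    have ia: "i \<noteq> a" using i aB by auto
    have e1: "(\<Sum>v\<in>pin_set (insert a B) - {Some i}. W (Some i) v * pin_ext x v) = W (Some i) (Some a) * x a + ?T"
      using ia aB by (simp add: insert_Diff_if)
    have "?S = W (Some a) (Some i) * x i + (\<Sum>v\<in>pin_set B - {Some i}. W (Some a) v * pin_ext x v)"
      unfolding star_sum_def using i by (subst sum.remove[of _ "Some i"]) auto
    then have e2: "(\<Sum>v\<in>pin_set B - {Some i}. star_mesh W a r (Some i) v * pin_ext x v)
       = ?T + r * W (Some a) (Some i) * (?S - W (Some a) (Some i) * x i)"
      by (simp add: star_mesh_def sum.distrib sum_distrib_left algebra_simps)
    have e3: "W (Some a) (Some i) = W (Some i) (Some a)"
      using i by (intro W_sym) auto
    show ?thesis unfolding e1 e2 e3 n_def xa using i S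
      by (simp add: field_simps)
  qed
  have "?L = P ** Q ** transpose P"
  proof (subst vec_eq_iff, intro allI, subst vec_eq_iff, intro allI)
    fix i j
    have Ws: "W (Some a) (Some i) = W (Some i) (Some a)" if "i \<in> B" for i
      using that by (intro W_sym) auto
    have Na: "?N $ i $ a = (if i = a then 1 else 0)" "?N $ a $ i = (if i = a then 1 else 0)" for i
      using aB by (auto simp: sub_laplacian_def)
    have Qa: "Q $ i $ a = (if i = a then x a * ?S else 0)" "Q $ a $ i = (if i = a then x a * ?S else 0)" for i
      using Na by (auto simp: Q_def)
    have Q: "Q $ i $ j = ?N $ i $ j" if "i \<noteq> a" for i j
      using that by (simp add: Q_def)
    have na: "n a = 0" using aB by (simp add: n_def)
    consider "i = a" "j = a" | "i = a" "j \<noteq> a" | "i \<noteq> a" "j = a" | "i \<noteq> a" "j \<noteq> a" "i = j" "i \<in> B" 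
      | "i \<noteq> a" "j \<noteq> a" "i \<noteq> j" "i \<in> B" "j \<in> B" | "i \<noteq> a" "j \<noteq> a" "i \<notin> B \<or> j \<notin> B" by blast
    then show "?L $ i $ j = (P ** Q ** transpose P) $ i $ j"
    proof cases
      case 1
      have "pin_set B - {Some a} = pin_set B" using aB by auto
      with 1 show ?thesis by (simp add: entry Qa na sub_laplacian_def star_sum_def)
    next
      case 2
      then show ?thesis using S aB Ws[of j] by (auto simp: entry Qa na sub_laplacian_def n_def)
    next
      case 3
      then show ?thesis using S aB by (auto simp: entry Qa na sub_laplacian_def n_def)
    next
      case 4
      then show ?thesis unfolding entry Qa Q[OF 4(1)] using diag[OF 4(4)]
        by (simp add: sub_laplacian_def del: pin_set_simps(3))
    next
      case 5
      then show ?thesis unfolding entry Qa Q[OF 5(1)] using S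
        by (simp add: sub_laplacian_def n_def xa star_mesh_def Ws field_simps)
    next
      case 6
      then show ?thesis unfolding entry Qa Q[OF 6(1)]
        by (auto simp: sub_laplacian_def n_def)
    qed
  qed
  moreover have "det P = 1"
  proof -
    \<comment> \<open>\<open>P\<close> is the identity with column \<open>a\<close> replaced, which
      is the shape evaluated by Cramer's rule.\<close>
    have "P = (\<chi> i j. if j = a then (mat 1 *v (\<chi> i. (if i = a then 1 else 0) + n i)) $ i else mat 1 $ i $ j)"
      unfolding matrix_vector_mul_lid by (auto simp: P_def vec_eq_iff mat_def)
    then have "det P = (\<chi> i. (if i = a then 1 else 0) + n i) $ a * det (mat 1 :: real^'n^'n)"
      by (simp only: cramer_lemma)
    then show ?thesis using aB by (simp add: n_def)
  qed
  moreover have "det Q = x a * ?S * det ?N"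
    unfolding Q_def by (subst det_row_mul) (intro arg_cong2[of _ _ _ _ "(*)"] arg_cong[of _ _ det], auto simp: vec_eq_iff)
  ultimately show ?thesis by (simp add: det_mul det_transpose)
qed

text \<open>Inserting \<open>x a = r * star_sum B W a x\<close> into the terms
  \<open>W (Some a) v * x a / x v\<close> gives the quadratic form of the new star-mesh weights. The
  terms with \<open>x a\<close> in the denominator sum to \<open>1 / r\<close>, and subtracting 1
  from every ratio accounts for the remaining constants.\<close>

lemma energy_star_mesh:
  fixes W :: "'n::finite option \<Rightarrow> 'n option \<Rightarrow> real"
  assumes aB: "a \<notin> B" and sym: "symmetric_weights (insert a B) W"
    and x: "\<And>i. 0 < x i" and r: "r \<noteq> 0"
    and S: "star_sum B W a x \<noteq> 0" and xa: "x a = r * star_sum B W a x"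
  shows "energy (insert a B) W x = energy B (star_mesh W a r) x
    + (r * (\<Sum>v\<in>pin_set B. W (Some a) v)\<^sup>2 / 2 - (\<Sum>v\<in>pin_set B. W (Some a) v) + 1 / (2 * r))"
proof -
  let ?X = "pin_ext x" and ?B = "pin_set B" and ?w = "W (Some a)"
  let ?M = "\<Sum>v\<in>?B. ?w v"
  have W_sym: "W v (Some a) = ?w v" if "v \<in> ?B" for v
    using that by (intro symmetric_weightsD[OF sym]) simp_all
  have X: "?X v \<noteq> 0" for v using pin_ext_pos[of x v] x by simp
  have nin: "Some a \<notin> ?B" using aB by simp
  have row: "(\<Sum>v\<in>?B. ?w v * (?X (Some a) / ?X v - 1)) = r * (\<Sum>u\<in>?B. \<Sum>v\<in>?B. ?w u * ?w v * (?X u / ?X v)) - ?M"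
  proof -
    have "(\<Sum>v\<in>?B. ?w v * (?X (Some a) / ?X v)) = (\<Sum>v\<in>?B. \<Sum>u\<in>?B. r * (?w u * ?w v * (?X u / ?X v)))"
      by (simp add: xa star_sum_def sum_distrib_left sum_distrib_right sum_divide_distrib algebra_simps)
    also have "\<dots> = r * (\<Sum>u\<in>?B. \<Sum>v\<in>?B. ?w u * ?w v * (?X u / ?X v))"
      by (subst sum.swap) (simp add: sum_distrib_left)
    finally show ?thesis by (simp add: right_diff_distrib sum_subtractf)
  qed
  have col: "(\<Sum>u\<in>?B. W u (Some a) * (?X u / ?X (Some a) - 1)) = 1 / r - ?M"
  proof -
    have "(\<Sum>u\<in>?B. W u (Some a) * (?X u / ?X (Some a) - 1)) = (\<Sum>u\<in>?B. ?w u * ?X u / x a - ?w u)"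
      by (intro sum.cong refl) (simp add: W_sym right_diff_distrib)
    also have "\<dots> = star_sum B W a x / x a - ?M"
      by (simp add: sum_subtractf star_sum_def sum_divide_distrib)
    finally show ?thesis using S r by (simp add: xa)
  qed
  have mesh: "(\<Sum>u\<in>?B. \<Sum>v\<in>?B. star_mesh W a r u v * (?X u / ?X v - 1))
     = (\<Sum>u\<in>?B. \<Sum>v\<in>?B. W u v * (?X u / ?X v - 1))
       + r * (\<Sum>u\<in>?B. \<Sum>v\<in>?B. ?w u * ?w v * (?X u / ?X v)) - r * ?M\<^sup>2"
  proof -
    have "?M\<^sup>2 = (\<Sum>u\<in>?B. \<Sum>v\<in>?B. ?w u * ?w v)"
      by (simp add: power2_eq_square sum_product)
    then show ?thesis
      by (simp add: star_mesh_def sum_distrib_left sum.distrib sum_subtractf algebra_simps)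
  qed
  have "(\<Sum>u\<in>pin_set (insert a B). \<Sum>v\<in>pin_set (insert a B). W u v * (?X u / ?X v - 1))
    = (\<Sum>v\<in>?B. ?w v * (?X (Some a) / ?X v - 1)) + (\<Sum>u\<in>?B. W u (Some a) * (?X u / ?X (Some a) - 1))
      + (\<Sum>u\<in>?B. \<Sum>v\<in>?B. W u v * (?X u / ?X v - 1))"
    using nin X[of "Some a"] by (simp add: sum.distrib del: pin_ext_simps)
  also have "\<dots> = (\<Sum>u\<in>?B. \<Sum>v\<in>?B. star_mesh W a r u v * (?X u / ?X v - 1)) + r * ?M\<^sup>2 - 2 * ?M + 1 / r"
    unfolding row col mesh by simp
  finally show ?thesis unfolding energy_def using r by (simp add: field_simps)
qed

lemma weight_star_mesh:
  fixes W :: "'n::finite option \<Rightarrow> 'n option \<Rightarrow> real"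
  assumes aB: "a \<notin> B" and sym: "symmetric_weights (insert a B) W"
    and x: "\<And>i. 0 < x i" and r: "0 < r"
    and S: "0 < star_sum B W a x" and xa: "x a = r * star_sum B W a x"
  shows "weight (insert a B) W x
    = eliminated_density (\<Sum>v\<in>pin_set B. W (Some a) v) r * weight B (star_mesh W a r) x"
proof -
  let ?S = "star_sum B W a x"
  \<comment> \<open>The square root of the pivot meets the factor \<open>1 / x a\<close> of the
    reference measure; only a power of \<open>r\<close> is left.\<close>
  have h1: "sqrt (x a * ?S) / x a = 1 / sqrt r"
  proof -
    have "sqrt (x a * ?S) = sqrt r * ?S"
      using S r by (simp add: xa real_sqrt_mult)
    moreover have "r = sqrt r * sqrt r" using r by simp
    then have "sqrt r / r = 1 / sqrt r" using r by (simp add: field_simps)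
    ultimately show ?thesis using S r by (simp add: xa)
  qed
  have h2: "sqrt (det (sub_laplacian (insert a B) W x))
      = sqrt (x a * ?S) * sqrt (det (sub_laplacian B (star_mesh W a r) x))"
    using det_star_mesh[OF aB sym _ xa] S by (simp add: real_sqrt_mult)
  have h3: "exp (- energy (insert a B) W x) = exp (- energy B (star_mesh W a r) x) *
     exp (- (r * (\<Sum>v\<in>pin_set B. W (Some a) v)\<^sup>2 / 2 - (\<Sum>v\<in>pin_set B. W (Some a) v) + 1 / (2 * r)))"
    using energy_star_mesh[OF aB sym x _ _ xa] S r by (simp add: mult_exp_exp)
  let ?M = "\<Sum>v\<in>pin_set B. W (Some a) v"
  have "weight (insert a B) W x = exp (- (r * ?M\<^sup>2 / 2 - ?M + 1 / (2 * r))) / sqrt (2 * pi)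
     * (sqrt (x a * ?S) / x a) * weight B (star_mesh W a r) x"
    using aB unfolding weight_def h2 h3 by (simp add: mult_ac)
  then show ?thesis unfolding h1 eliminated_density_def by simp
qed

section \<open>Inverse Gaussian densities\<close>

text \<open>The density of \<open>ln X\<close> for \<open>X\<close> inverse Gaussian with mean \<open>1\<close> and shape \<open>w\<close>.\<close>

definition ig_density :: "real \<Rightarrow> real \<Rightarrow> real" where
  "ig_density w t = sqrt (w / (2 * pi)) * exp (- t / 2) * exp (- w * (cosh t - 1))"

lemma ig_density_nonneg [simp]: "0 \<le> w \<Longrightarrow> 0 \<le> ig_density w t"
  by (simp add: ig_density_def)

lemma borel_measurable_ig_density [measurable]:
  "(\<lambda>t. ig_density w t) \<in> borel_measurable borel"
  unfolding ig_density_def cosh_def by measurable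

text \<open>Monotone exhaustion, used to carry the substitution rule from compact intervals to the
  whole line.\<close>

lemma nn_integral_SUP_indicator:
  fixes f :: "'a \<Rightarrow> ennreal"
  assumes [measurable]: "f \<in> borel_measurable M" "\<And>n. A n \<in> sets M"
    and "incseq A" and U: "(\<Union>n. A n) = UNIV"
  shows "(\<integral>\<^sup>+x. f x \<partial>M) = (SUP n. \<integral>\<^sup>+x. f x * indicator (A n) x \<partial>M)"
proof -
  have "(SUP n. f x * indicator (A n) x) = f x" for x
  proof (rule antisym)
    show "(SUP n. f x * indicator (A n) x) \<le> f x"
      by (intro SUP_least) (auto simp: indicator_def)
    obtain n where "x \<in> A n" using U by blast
    then show "f x \<le> (SUP n. f x * indicator (A n) x)"
      by (intro SUP_upper2[of n]) auto
  qed
  then have "(\<integral>\<^sup>+x. f x \<partial>M) = (\<integral>\<^sup>+x. (SUP n. f x * indicator (A n) x) \<partial>M)" by simp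
  also have "\<dots> = (SUP n. \<integral>\<^sup>+x. f x * indicator (A n) x \<partial>M)"
    using \<open>incseq A\<close>
    by (intro nn_integral_monotone_convergence_SUP)
       (auto simp: incseq_def le_fun_def indicator_def subset_eq)
  finally show ?thesis .
qed

text \<open>Size-biasing the law of \<open>X\<close> amounts to reflecting \<open>ln X\<close>. The
  mean therefore equals the mass.\<close>

lemma nn_integral_ig_density_reflect:
  "(\<integral>\<^sup>+t. ennreal (exp t * ig_density w t) \<partial>lborel) = (\<integral>\<^sup>+t. ennreal (ig_density w t) \<partial>lborel)"
proof -
  have "(\<integral>\<^sup>+t. ennreal (exp t * ig_density w t) \<partial>lborel)
      = ennreal \<bar>-1\<bar> * (\<integral>\<^sup>+t. ennreal (exp (0 + -1 * t) * ig_density w (0 + -1 * t)) \<partial>lborel)"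
    by (rule nn_integral_real_affine) auto
  also have "\<dots> = (\<integral>\<^sup>+t. ennreal (ig_density w t) \<partial>lborel)"
  proof -
    have "exp (0 + -1 * t) * ig_density w (0 + -1 * t) = ig_density w t" for t
      unfolding ig_density_def by (simp add: mult_exp_exp[symmetric] mult_ac flip: exp_add)
    then show ?thesis by (simp only:) simp
  qed
  finally show ?thesis .
qed

text \<open>The substitution \<open>y = 2 sqrt w sinh (t / 2)\<close> turns the even part of the density into a Gaussian.\<close>

lemma nn_integral_ig_density:
  assumes w: "0 < w"
  shows "(\<integral>\<^sup>+t. ennreal (ig_density w t) \<partial>lborel) = 1"
proof -
  define g where "g t = 2 * sqrt w * sinh (t / 2)" for t
  define g' where "g' t = sqrt w * cosh (t / 2)" for t
  have g'_nonneg: "0 \<le> g' t" for t using w by (simp add: g'_def)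
  have deriv: "(g has_real_derivative g' t) (at t)" for t
    unfolding g_def g'_def by (auto intro!: derivative_eq_intros)
  have mono: "g s \<le> g t" if "s \<le> t" for s t
    using that w by (simp add: g_def)
  have surj: "\<exists>t. g t = y" for y
    using w by (intro exI[of _ "2 * arsinh (y / (2 * sqrt w))"]) (simp add: g_def sinh_arsinh_real)
  have cont': "continuous_on S g'" for S
    unfolding g'_def by (auto intro!: continuous_intros)
  let ?n = "\<lambda>y. ennreal (std_normal_density y)"
  have meas_g: "g \<in> borel_measurable borel" "g' \<in> borel_measurable borel"
    unfolding g_def g'_def sinh_def cosh_def by measurable
  have "(\<integral>\<^sup>+t. ?n (g t) * g' t \<partial>lborel) = (\<integral>\<^sup>+y. ?n y \<partial>lborel)"
  proof -
    have "(\<integral>\<^sup>+t. ?n (g t) * g' t \<partial>lborel)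
        = (SUP n. \<integral>\<^sup>+t. ?n (g t) * g' t * indicator {- real (Suc n)..real (Suc n)} t \<partial>lborel)"
    proof (rule nn_integral_SUP_indicator)
      show "(\<Union>n. {- real (Suc n)..real (Suc n)}) = UNIV"
      proof (intro set_eqI iffI UNIV_I)
        fix x :: real
        obtain n where "\<bar>x\<bar> \<le> real n" using real_arch_simple by blast
        then have "x \<in> {- real (Suc n)..real (Suc n)}" by auto
        then show "x \<in> (\<Union>n. {- real (Suc n)..real (Suc n)})" by blast
      qed
    qed (use meas_g in \<open>auto simp: incseq_def\<close>)
    also have "\<dots> = (SUP n. \<integral>\<^sup>+y. ?n y * indicator {g (- real (Suc n))..g (real (Suc n))} y \<partial>lborel)"
      by (intro SUP_cong refl nn_integral_substitution_aux[symmetric] deriv g'_nonneg cont') auto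
    also have "\<dots> = (\<integral>\<^sup>+y. ?n y \<partial>lborel)"
    proof (rule nn_integral_SUP_indicator[symmetric])
      show "(\<Union>n. {g (- real (Suc n))..g (real (Suc n))}) = UNIV"
      proof (intro set_eqI iffI UNIV_I)
        fix y :: real
        obtain t where t: "g t = y" using surj by blast
        obtain n where "\<bar>t\<bar> \<le> real n" using real_arch_simple by blast
        then have "y \<in> {g (- real (Suc n))..g (real (Suc n))}" unfolding t[symmetric] by (auto intro!: mono)
        then show "y \<in> (\<Union>n. {g (- real (Suc n))..g (real (Suc n))})" by blast
      qed
      show "incseq (\<lambda>n. {g (- real (Suc n))..g (real (Suc n))})"
        unfolding incseq_def by (auto intro: order_trans[OF mono] order_trans[OF _ mono])
    qed auto
    finally show ?thesis .
  qed
  also have "(\<integral>\<^sup>+y. ?n y \<partial>lborel) = 1"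
    by (subst nn_integral_eq_integral) auto
  finally have gauss: "(\<integral>\<^sup>+t. ?n (g t) * g' t \<partial>lborel) = 1" .
  \<comment> \<open>The identity \<open>cosh t - 1 = 2 * (sinh (t / 2))\<^sup>2\<close> matches the
    exponents. The derivative contributes \<open>cosh (t / 2)\<close>, half the sum of
    \<open>exp (- t / 2)\<close> and \<open>exp (t / 2)\<close>, which belong to the density and its
    reflection.\<close>
  have pt: "2 * (?n (g t) * g' t) = ennreal (ig_density w t) + ennreal (exp t * ig_density w t)" for t
  proof -
    have "(g t)\<^sup>2 / 2 = w * (cosh t - 1)"
    proof -
      have "cosh t = cosh (t/2 + t/2)" by simp
      also have "\<dots> = cosh (t/2) * cosh (t/2) + sinh (t/2) * sinh (t/2)" by (rule cosh_add)
      also have "\<dots> = 1 + 2 * (sinh (t/2))\<^sup>2"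
        using cosh_square_eq[of "t/2"] by (simp add: power2_eq_square)
      finally show ?thesis using w by (simp add: g_def power_mult_distrib)
    qed
    then have n: "std_normal_density (g t) = exp (- w * (cosh t - 1)) / sqrt (2 * pi)"
      by (simp add: std_normal_density_def)
    have "2 * (std_normal_density (g t) * g' t) = ig_density w t + exp t * ig_density w t"
    proof -
      have "exp t * exp (- t / 2) = exp (t / 2)" by (simp flip: exp_add)
      then have "ig_density w t + exp t * ig_density w t
        = sqrt (w / (2 * pi)) * exp (- w * (cosh t - 1)) * (exp (- t / 2) + exp (t / 2))"
        by (simp add: ig_density_def algebra_simps)
      then show ?thesis
        unfolding n by (simp add: g'_def cosh_def real_sqrt_divide field_simps)
    qed
    then have "ennreal (2 * (std_normal_density (g t) * g' t)) = ennreal (ig_density w t + exp t * ig_density w t)"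
      by simp
    moreover have "ennreal (2 * (std_normal_density (g t) * g' t)) = 2 * (?n (g t) * g' t)"
      using g'_nonneg by (simp add: ennreal_mult)
    moreover have "ennreal (ig_density w t + exp t * ig_density w t)
       = ennreal (ig_density w t) + ennreal (exp t * ig_density w t)"
      using w by simp
    ultimately show ?thesis by simp
  qed
  have "2 = (\<integral>\<^sup>+t. 2 * (?n (g t) * g' t) \<partial>lborel)"
    using meas_g by (subst nn_integral_cmult) (auto simp: gauss)
  also have "\<dots> = (\<integral>\<^sup>+t. ennreal (ig_density w t) \<partial>lborel) + (\<integral>\<^sup>+t. ennreal (exp t * ig_density w t) \<partial>lborel)"
    unfolding pt by (subst nn_integral_add) auto
  also have "\<dots> = 2 * (\<integral>\<^sup>+t. ennreal (ig_density w t) \<partial>lborel)"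
    unfolding nn_integral_ig_density_reflect by (simp add: mult_2)
  finally have "2 * (\<integral>\<^sup>+t. ennreal (ig_density w t) \<partial>lborel) = 2 * 1" by simp
  then show ?thesis
    by (subst (asm) ennreal_mult_cancel_left) auto
qed

section \<open>Convex order of inverse Gaussian laws\<close>

lemma convex_on_chord:
  fixes f :: "real \<Rightarrow> real"
  assumes f: "convex_on {0<..} f" and a: "0 < a" and ab: "a < b"
  shows "a \<le> x \<Longrightarrow> x \<le> b \<Longrightarrow> f x \<le> (f b - f a) / (b - a) * (x - a) + f a"
    and "0 < x \<Longrightarrow> x \<le> a \<or> b \<le> x \<Longrightarrow> (f b - f a) / (b - a) * (x - a) + f a \<le> f x"
proof -
  have chord: "f y \<le> (f d - f c) / (d - c) * (y - c) + f c" if "0 < c" "c \<le> y" "y \<le> d" for c d y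
    using that by (intro convex_onD_Icc' convex_on_subset[OF f]) auto
  show "a \<le> x \<Longrightarrow> x \<le> b \<Longrightarrow> f x \<le> (f b - f a) / (b - a) * (x - a) + f a"
    using chord[OF a] by simp
  show "(f b - f a) / (b - a) * (x - a) + f a \<le> f x" if x: "0 < x" "x \<le> a \<or> b \<le> x"
  proof -
    consider "x = a" | "x < a" | "b \<le> x" using x by linarith
    then show ?thesis
    proof cases
      case 2
      then have "f a \<le> (f b - f x) / (b - x) * (a - x) + f x"
        using chord[of x a b] x ab by simp
      then have "f a * (b - x) \<le> (f b - f x) * (a - x) + f x * (b - x)"
        using 2 ab by (simp add: field_simps)
      then show ?thesis using ab by (simp add: field_simps)
    next
      case 3
      then have "f b \<le> (f x - f a) / (x - a) * (b - a) + f a"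
        using chord[of a b x] a ab by simp
      then have "f b * (x - a) \<le> (f x - f a) * (b - a) + f a * (x - a)"
        using 3 ab by (simp add: field_simps)
      then show ?thesis using ab by (simp add: field_simps)
    qed simp
  qed
qed

lemma ig_density_le_iff_ln:
  assumes "0 < v" "0 < w"
  shows "ig_density v t \<le> ig_density w t
    \<longleftrightarrow> ln v / 2 - v * (cosh t - 1) \<le> ln w / 2 - w * (cosh t - 1)"
proof -
  have e: "ig_density u t = (exp (- t / 2) / sqrt (2 * pi)) * exp (ln u / 2 - u * (cosh t - 1))"
    if "0 < u" for u
  proof -
    have "exp (ln u / 2) = sqrt u"
      using that by (simp add: powr_half_sqrt[symmetric] powr_def)
    moreover have "exp (ln u / 2 - u * (cosh t - 1)) = exp (ln u / 2) * exp (- u * (cosh t - 1))"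
      by (simp flip: exp_add)
    ultimately show ?thesis by (simp add: ig_density_def real_sqrt_divide)
  qed
  have "0 < exp (- t / 2) / sqrt (2 * pi)" by simp
  then show ?thesis
    unfolding e[OF assms(1)] e[OF assms(2)] by (subst mult_le_cancel_left_pos) simp_all
qed

text \<open>The factor \<open>exp (- t / 2)\<close> is common to both densities. After taking
  logarithms the comparison is linear in \<open>cosh t - 1\<close>, with a single threshold.\<close>

lemma ig_density_crossing:
  assumes "0 < w" "w < w'"
  shows "ig_density w' t \<le> ig_density w t \<longleftrightarrow> ln (w' / w) / (2 * (w' - w)) \<le> cosh t - 1"
    and "ig_density w t \<le> ig_density w' t \<longleftrightarrow> cosh t - 1 \<le> ln (w' / w) / (2 * (w' - w))"
proof -
  have d: "0 < 2 * (w' - w)" and w': "0 < w'" using assms by auto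
  have l: "ln (w' / w) = ln w' - ln w" using assms w' by (simp add: ln_div)
  have m: "(cosh t - 1) * (2 * (w' - w)) = 2 * (w' * (cosh t - 1)) - 2 * (w * (cosh t - 1))"
    by (simp add: algebra_simps)
  show "ig_density w' t \<le> ig_density w t \<longleftrightarrow> ln (w' / w) / (2 * (w' - w)) \<le> cosh t - 1"
    unfolding ig_density_le_iff_ln[OF w' assms(1)] pos_divide_le_eq[OF d] l m by linarith
  show "ig_density w t \<le> ig_density w' t \<longleftrightarrow> cosh t - 1 \<le> ln (w' / w) / (2 * (w' - w))"
    unfolding ig_density_le_iff_ln[OF assms(1) w'] pos_le_divide_eq[OF d] l m by linarith
qed

text \<open>
  The two densities cross exactly at \<open>t = \<plusminus>t\<^sub>0\<close>. Subtracting from \<open>f\<close> its chord through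
  \<open>exp (\<plusminus>t\<^sub>0)\<close> makes the integrand of the difference pointwise nonnegative, and the chord
  integrates equally against both because they share mass and mean.
\<close>

lemma ig_convex_order:
  fixes f :: "real \<Rightarrow> real"
  assumes w: "0 < w" "w \<le> w'" and f: "convex_on {0<..} f" and f_nonneg: "\<And>x. 0 < x \<Longrightarrow> 0 \<le> f x"
    and [measurable]: "(\<lambda>t. f (exp t)) \<in> borel_measurable borel"
  shows "(\<integral>\<^sup>+t. ennreal (f (exp t) * ig_density w' t) \<partial>lborel)
    \<le> (\<integral>\<^sup>+t. ennreal (f (exp t) * ig_density w t) \<partial>lborel)"
proof (cases "w = w'")
  case False
  then have ww': "w < w'" using w by simp
  then have w': "0 < w'" using w by simp
  define k where "k = ln (w' / w) / (2 * (w' - w))"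
  have "0 < k" using ww' w by (simp add: k_def)
  define t0 where "t0 = arcosh (k + 1)"
  have t0: "0 < t0" "cosh t0 = k + 1"
    using \<open>0 < k\<close> by (auto simp: t0_def cosh_arcosh_real)
  define a where "a = exp (- t0)" define b where "b = exp t0"
  have ab: "0 < a" "a < b" using t0 by (auto simp: a_def b_def)
  define \<beta> where "\<beta> = (f b - f a) / (b - a)"
  define \<alpha> where "\<alpha> = f a - \<beta> * a"
  let ?p = "ig_density w" and ?q = "ig_density w'"
  have key: "0 \<le> (f (exp t) - (\<alpha> + \<beta> * exp t)) * (?p t - ?q t)" for t
  proof (cases "\<bar>t\<bar> \<le> t0")
    case True
    have "cosh \<bar>t\<bar> \<le> cosh t0" using True by (subst cosh_real_nonneg_le_iff) auto
    then have le: "?p t \<le> ?q t" unfolding ig_density_crossing(2)[OF w(1) ww'] using t0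
      by (simp add: k_def)
    have "f (exp t) \<le> \<beta> * (exp t - a) + f a" unfolding \<beta>_def
      by (rule convex_on_chord[OF f ab]) (use True in \<open>auto simp: a_def b_def\<close>)
    then have "f (exp t) - (\<alpha> + \<beta> * exp t) \<le> 0" by (simp add: \<alpha>_def algebra_simps)
    with le show ?thesis by (intro mult_nonpos_nonpos) auto
  next
    case out: False
    have "cosh t0 \<le> cosh \<bar>t\<bar>" using out t0 by (subst cosh_real_nonneg_le_iff) auto
    then have le: "?q t \<le> ?p t" unfolding ig_density_crossing(1)[OF w(1) ww'] using t0
      by (simp add: k_def)
    have "\<beta> * (exp t - a) + f a \<le> f (exp t)" unfolding \<beta>_def
      by (rule convex_on_chord[OF f ab]) (use out in \<open>auto simp: a_def b_def\<close>)
    then have "0 \<le> f (exp t) - (\<alpha> + \<beta> * exp t)" by (simp add: \<alpha>_def algebra_simps)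
    with le show ?thesis by (intro mult_nonneg_nonneg) auto
  qed
  \<comment> \<open>The chord is split into two nonnegative functions with finite integrals. Both
    sides can then be compared as sums of nonnegative integrals, from which the common finite part
    is cancelled.\<close>
  define l1 where "l1 t = max 0 \<alpha> + max 0 \<beta> * exp t" for t :: real
  define l2 where "l2 t = max 0 (- \<alpha>) + max 0 (- \<beta>) * exp t" for t :: real
  have l12: "l1 t - l2 t = \<alpha> + \<beta> * exp t" for t
    by (auto simp: l1_def l2_def max_def)
  have l_nonneg: "0 \<le> l1 t" "0 \<le> l2 t" for t by (auto simp: l1_def l2_def)
  have [measurable]: "l1 \<in> borel_measurable borel" "l2 \<in> borel_measurable borel"
    unfolding l1_def l2_def by measurable
  have int_lin: "(\<integral>\<^sup>+t. ennreal ((c + d * exp t) * ig_density v t) \<partial>lborel) = ennreal (c + d)"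
    if "0 \<le> c" "0 \<le> d" "0 < v" for c d v
  proof -
    have "(\<integral>\<^sup>+t. ennreal ((c + d * exp t) * ig_density v t) \<partial>lborel)
      = (\<integral>\<^sup>+t. ennreal c * ennreal (ig_density v t) + ennreal d * ennreal (exp t * ig_density v t) \<partial>lborel)"
      using that by (intro nn_integral_cong)
        (simp add: ennreal_mult[symmetric] ennreal_plus[symmetric] algebra_simps del: ennreal_plus)
    also have "\<dots> = ennreal c + ennreal d"
      using that by (simp add: nn_integral_add nn_integral_cmult nn_integral_ig_density_reflect nn_integral_ig_density)
    finally show ?thesis using that by simp
  qed
  have l_int: "(\<integral>\<^sup>+t. ennreal (l1 t * ?q t) \<partial>lborel) = (\<integral>\<^sup>+t. ennreal (l1 t * ?p t) \<partial>lborel)"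
    "(\<integral>\<^sup>+t. ennreal (l2 t * ?q t) \<partial>lborel) = (\<integral>\<^sup>+t. ennreal (l2 t * ?p t) \<partial>lborel)"
    "(\<integral>\<^sup>+t. ennreal (l1 t * ?p t) \<partial>lborel) < \<infinity>" "(\<integral>\<^sup>+t. ennreal (l2 t * ?p t) \<partial>lborel) < \<infinity>"
    unfolding l1_def l2_def using w w' by (auto simp: int_lin)
  have pq: "0 \<le> ?p t" "0 \<le> ?q t" for t using w w' by simp_all
  have split: "(\<integral>\<^sup>+t. ennreal (f (exp t) * r t) + (ennreal (l1 t * s t) + ennreal (l2 t * r t)) \<partial>lborel)
      = (\<integral>\<^sup>+t. ennreal (f (exp t) * r t) \<partial>lborel) +
        ((\<integral>\<^sup>+t. ennreal (l1 t * s t) \<partial>lborel) + (\<integral>\<^sup>+t. ennreal (l2 t * r t) \<partial>lborel))"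
    if [measurable]: "r \<in> borel_measurable borel" "s \<in> borel_measurable borel" for r s :: "real \<Rightarrow> real"
    by (simp add: nn_integral_add)
  have "(\<integral>\<^sup>+t. ennreal (f (exp t) * ?q t) + (ennreal (l1 t * ?p t) + ennreal (l2 t * ?q t)) \<partial>lborel)
     \<le> (\<integral>\<^sup>+t. ennreal (f (exp t) * ?p t) + (ennreal (l1 t * ?q t) + ennreal (l2 t * ?p t)) \<partial>lborel)"
  proof (rule nn_integral_mono)
    fix t
    have fn: "0 \<le> f (exp t)" using f_nonneg by simp
    have "f (exp t) * ?q t + (l1 t * ?p t + l2 t * ?q t) \<le> f (exp t) * ?p t + (l1 t * ?q t + l2 t * ?p t)"
      using key[of t] unfolding l12[symmetric] by (simp add: algebra_simps)
    then show "ennreal (f (exp t) * ?q t) + (ennreal (l1 t * ?p t) + ennreal (l2 t * ?q t))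
      \<le> ennreal (f (exp t) * ?p t) + (ennreal (l1 t * ?q t) + ennreal (l2 t * ?p t))"
      using fn l_nonneg pq by (simp add: ennreal_plus[symmetric] del: ennreal_plus)
  qed
  then have le: "(\<integral>\<^sup>+t. ennreal (f (exp t) * ?q t) \<partial>lborel) + ((\<integral>\<^sup>+t. ennreal (l1 t * ?p t) \<partial>lborel) + (\<integral>\<^sup>+t. ennreal (l2 t * ?p t) \<partial>lborel))
     \<le> (\<integral>\<^sup>+t. ennreal (f (exp t) * ?p t) \<partial>lborel) + ((\<integral>\<^sup>+t. ennreal (l1 t * ?p t) \<partial>lborel) + (\<integral>\<^sup>+t. ennreal (l2 t * ?p t) \<partial>lborel))"
    unfolding split[OF borel_measurable_ig_density borel_measurable_ig_density] l_int(1,2) .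
  have cancel: "x \<le> y" if "x + c \<le> y + c" "c < \<infinity>" for x y c :: ennreal
    using that by (auto simp: add.commute[of _ c] ennreal_add_left_cancel_le)
  show ?thesis using le l_int(3,4) by (intro cancel[OF le]) simp
qed simp

section \<open>Elimination of a vertex\<close>

text \<open>If \<open>s\<close> has the law of the eliminated variable, then
  \<open>M * exp s\<close> is inverse Gaussian with mean 1 and shape \<open>M\<close>.\<close>

lemma eliminated_density_shift:
  assumes "0 < M"
  shows "eliminated_density M (exp (- ln M + t)) = ig_density M t"
proof -
  have r: "exp (- ln M + t) = exp t / M" using assms by (simp add: exp_diff)
  have "sqrt (exp t) = exp (t / 2)"
    by (rule real_sqrt_unique) (simp_all add: power2_eq_square flip: exp_add)
  then have "1 / sqrt (exp t / M) = sqrt M * exp (- t / 2)"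
    using assms by (simp add: real_sqrt_divide exp_minus field_simps)
  moreover have "exp t / M * M\<^sup>2 / 2 - M + 1 / (2 * (exp t / M)) = M * (cosh t - 1)"
    using assms by (simp add: cosh_def exp_minus power2_eq_square field_simps)
  moreover have "eliminated_density M (exp t / M)
     = exp (- (exp t / M * M\<^sup>2 / 2 - M + 1 / (2 * (exp t / M)))) * (1 / sqrt (exp t / M)) / sqrt (2 * pi)"
    by (simp add: eliminated_density_def)
  ultimately show ?thesis unfolding r by (simp add: ig_density_def real_sqrt_divide)
qed

lemma borel_measurable_eliminated_density [measurable]:
  assumes [measurable]: "f \<in> borel_measurable M"
  shows "(\<lambda>x. eliminated_density c (f x)) \<in> borel_measurable M"
  unfolding eliminated_density_def by measurable

lemma eliminated_density_nonneg [simp]: "0 \<le> r \<Longrightarrow> 0 \<le> eliminated_density M r"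
  by (simp add: eliminated_density_def)

lemma nn_integral_eliminated_density_shift:
  fixes g :: "real \<Rightarrow> ennreal"
  assumes M: "0 < M" and [measurable]: "g \<in> borel_measurable borel"
  shows "(\<integral>\<^sup>+s. ennreal (eliminated_density M (exp s)) * g (M * exp s) \<partial>lborel)
    = (\<integral>\<^sup>+t. ennreal (ig_density M t) * g (exp t) \<partial>lborel)"
proof -
  have "(\<integral>\<^sup>+s. ennreal (eliminated_density M (exp s)) * g (M * exp s) \<partial>lborel)
    = ennreal \<bar>1\<bar> * (\<integral>\<^sup>+t. ennreal (eliminated_density M (exp (- ln M + 1 * t))) * g (M * exp (- ln M + 1 * t)) \<partial>lborel)"
    by (rule nn_integral_real_affine) auto
  also have "\<dots> = (\<integral>\<^sup>+t. ennreal (ig_density M t) * g (exp t) \<partial>lborel)"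
  proof -
    have "M * exp (- ln M + t) = exp t" for t using M by (simp add: exp_diff)
    then show ?thesis using M by (simp only: eliminated_density_shift mult_1) simp
  qed
  finally show ?thesis .
qed

lemma nn_integral_eliminated_density:
  assumes "0 < M"
  shows "(\<integral>\<^sup>+s. ennreal (eliminated_density M (exp s)) \<partial>lborel) = 1"
  using nn_integral_eliminated_density_shift[OF assms, of "\<lambda>_. 1"] nn_integral_ig_density[OF assms] by simp

section \<open>Integrals of the field on a subset of the vertices\<close>

abbreviation fun_borel :: "('n \<Rightarrow> real) measure" where
  "fun_borel \<equiv> PiM UNIV (\<lambda>_. borel)"

abbreviation coord_lborel :: "'n set \<Rightarrow> ('n \<Rightarrow> real) measure" where
  "coord_lborel A \<equiv> PiM A (\<lambda>_. lborel)"

text \<open>The integration runs over the coordinates in \<open>A\<close> only, while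
  \<open>f\<close> still takes full vectors whose other entries are \<open>exp undefined\<close>.
  Vertices can thus be removed under a fixed index type.\<close>

definition field_int ::
    "'n::finite set \<Rightarrow> ('n option \<Rightarrow> 'n option \<Rightarrow> real) \<Rightarrow> (('n \<Rightarrow> real) \<Rightarrow> ennreal) \<Rightarrow> ennreal" where
  "field_int A W f = (\<integral>\<^sup>+t. f (\<lambda>i. exp (t i)) * ennreal (weight A W (\<lambda>i. exp (t i))) \<partial>coord_lborel A)"

lemma measurable_fun_borelI:
  assumes "\<And>i. (\<lambda>p. x p i) \<in> borel_measurable M"
  shows "x \<in> M \<rightarrow>\<^sub>M fun_borel"
  by (rule measurable_PiM_single') (use assms in auto)

lemma measurable_coord [measurable]:
  "(\<lambda>t. t i) \<in> borel_measurable (coord_lborel A)"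
proof (cases "i \<in> A")
  case True
  then have "(\<lambda>t. t i) \<in> coord_lborel A \<rightarrow>\<^sub>M lborel" by (rule measurable_component_singleton)
  then show ?thesis by simp
next
  case False
  then have "t i = undefined" if "t \<in> space (coord_lborel A)" for t :: "_ \<Rightarrow> real"
    using that by (auto simp: space_PiM PiE_def extensional_def)
  then show ?thesis by (subst measurable_cong[where g = "\<lambda>_. undefined"]) auto
qed

text \<open>The weights may vary with the parameter \<open>p\<close>, since after an elimination
  they depend on the integration variable \<open>s\<close>.\<close>

lemma borel_measurable_weight:
  assumes [measurable]: "\<And>u v. (\<lambda>p. W p u v) \<in> borel_measurable M" "\<And>i. (\<lambda>p. x p i) \<in> borel_measurable M"
  shows "(\<lambda>p. weight A (W p) (x p)) \<in> borel_measurable M"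
proof -
  have [measurable]: "(\<lambda>p. pin_ext (x p) v) \<in> borel_measurable M" for v
    by (cases v) auto
  have [measurable]: "(\<lambda>p. sub_laplacian A (W p) (x p) $ i $ j) \<in> borel_measurable M" for i j
    unfolding sub_laplacian_def by (cases "i \<in> A \<and> j \<in> A"; cases "i = j") simp_all
  show ?thesis unfolding weight_def energy_def det_def by measurable
qed

definition pos_weights :: "'n set \<Rightarrow> ('n option \<Rightarrow> 'n option \<Rightarrow> real) \<Rightarrow> bool" where
  "pos_weights A W \<longleftrightarrow> symmetric_weights A W \<and>
     (\<forall>u\<in>pin_set A. \<forall>v\<in>pin_set A. u \<noteq> v \<longrightarrow> 0 < W u v)"

lemma star_sum_pos:
  assumes "pos_weights (insert a B) W" "a \<notin> B" "\<And>i. 0 < x i"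
  shows "0 < star_sum B W a x"
  unfolding star_sum_def
proof (rule sum_pos)
  fix v assume v: "v \<in> pin_set B"
  then have "Some a \<noteq> v" using assms(2) by auto
  then have "0 < W (Some a) v" using assms(1) v by (auto simp: pos_weights_def)
  then show "0 < W (Some a) v * pin_ext x v" using assms(3) by (simp add: pin_ext_pos)
qed (auto simp: pin_set_def)

lemma weight_fun_upd:
  assumes "a \<notin> B"
  shows "weight B W (x(a := y)) = weight B W x"
proof -
  have p: "pin_ext (x(a := y)) v = pin_ext x v" if "v \<in> pin_set B" for v
    using that assms by (cases v) auto
  have "sub_laplacian B W (x(a := y)) = sub_laplacian B W x"
    using assms by (auto simp: sub_laplacian_def vec_eq_iff p intro!: sum.cong)
  moreover have "energy B W (x(a := y)) = energy B W x"
    by (simp add: energy_def p)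
  moreover have "(\<Prod>i\<in>B. 1 / ((x(a := y)) i * sqrt (2 * pi))) = (\<Prod>i\<in>B. 1 / (x i * sqrt (2 * pi)))"
    using assms by (intro prod.cong) auto
  ultimately show ?thesis by (simp add: weight_def)
qed

lemma star_sum_fun_upd:
  assumes "a \<notin> B"
  shows "star_sum B W a (x(a := y)) = star_sum B W a x"
proof -
  have p: "pin_ext (x(a := y)) v = pin_ext x v" if "v \<in> pin_set B" for v
    using that assms by (cases v) auto
  show ?thesis by (simp add: star_sum_def p)
qed

text \<open>The coordinate at \<open>a\<close> is integrated first, after the translation by
  \<open>ln (star_sum B W a x)\<close>, which preserves Lebesgue measure. The weight then factors,
  and exchanging the integrals leaves the star-mesh field on \<open>B\<close> for each fixed
  \<open>s\<close>.\<close>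

lemma field_int_eliminate:
  fixes W :: "'n::finite option \<Rightarrow> 'n option \<Rightarrow> real"
  assumes aB: "a \<notin> B" and W: "pos_weights (insert a B) W" and f: "f \<in> borel_measurable fun_borel"
  shows "field_int (insert a B) W f =
    (\<integral>\<^sup>+s. ennreal (eliminated_density (\<Sum>v\<in>pin_set B. W (Some a) v) (exp s)) *
       field_int B (star_mesh W a (exp s)) (\<lambda>x. f (x(a := exp s * star_sum B W a x))) \<partial>lborel)"
proof -
  interpret product_sigma_finite "\<lambda>_::'n. lborel :: real measure" by standard
  interpret P: pair_sigma_finite "lborel :: real measure" "coord_lborel B" 
    by (intro pair_sigma_finite.intro sigma_finite lborel.sigma_finite_measure_axioms) simp
  let ?e = "\<lambda>t i. exp (t i) :: real"
  let ?S = "\<lambda>t. star_sum B W a (?e t)"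
  let ?M = "\<Sum>v\<in>pin_set B. W (Some a) v"
  have sym: "symmetric_weights (insert a B) W" using W by (simp add: pos_weights_def)
  have S_pos: "0 < ?S t" for t by (rule star_sum_pos[OF W aB]) simp
  have fm: "(\<lambda>p. f (x p)) \<in> borel_measurable M" if "\<And>i. (\<lambda>p. x p i) \<in> borel_measurable M"
    for x and M :: "'c measure"
    using measurable_compose[OF measurable_fun_borelI f, of x M] that by simp
  have [measurable]: "(\<lambda>t. ?S t) \<in> borel_measurable (coord_lborel B)"
  proof -
    have [measurable]: "(\<lambda>t. pin_ext (?e t) v) \<in> borel_measurable (coord_lborel B)" for v
      by (cases v) auto
    show ?thesis unfolding star_sum_def by measurable
  qed
  define G where "G s t = ennreal (eliminated_density ?M (exp s)) *
     (f ((?e t)(a := exp s * ?S t)) * ennreal (weight B (star_mesh W a (exp s)) (?e t)))" for s t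
  have G_meas: "case_prod G \<in> borel_measurable (lborel \<Otimes>\<^sub>M coord_lborel B)"
  proof -
    have 1: "(\<lambda>p. f ((?e (snd p))(a := exp (fst p) * ?S (snd p)))) \<in> borel_measurable (lborel \<Otimes>\<^sub>M coord_lborel B)"
    proof (rule fm)
      fix i show "(\<lambda>p. ((?e (snd p))(a := exp (fst p) * ?S (snd p))) i) \<in> borel_measurable (lborel \<Otimes>\<^sub>M coord_lborel B)"
        by (cases "i = a") auto
    qed
    have 2: "(\<lambda>p. weight B (star_mesh W a (exp (fst p))) (?e (snd p))) \<in> borel_measurable (lborel \<Otimes>\<^sub>M coord_lborel B)"
      by (rule borel_measurable_weight) (auto simp: star_mesh_def)
    note [measurable] = 1 2
    show ?thesis unfolding G_def case_prod_beta by measurable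
  qed
  have "field_int (insert a B) W f = (\<integral>\<^sup>+t. (\<integral>\<^sup>+y. f (?e (t(a := y))) * ennreal (weight (insert a B) W (?e (t(a := y)))) \<partial>lborel) \<partial>coord_lborel B)"
    unfolding field_int_def
  proof (rule product_nn_integral_insert)
    have [measurable]: "(\<lambda>t. f (?e t)) \<in> borel_measurable (coord_lborel (insert a B))"
      by (rule fm) auto
    have [measurable]: "(\<lambda>t. weight (insert a B) W (?e t)) \<in> borel_measurable (coord_lborel (insert a B))"
      by (rule borel_measurable_weight) auto
    show "(\<lambda>t. f (?e t) * ennreal (weight (insert a B) W (?e t))) \<in> borel_measurable (coord_lborel (insert a B))"
      by measurable
  qed (use aB in auto)
  also have "\<dots> = (\<integral>\<^sup>+t. (\<integral>\<^sup>+s. G s t \<partial>lborel) \<partial>coord_lborel B)"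
  proof (rule nn_integral_cong)
    fix t :: "'n \<Rightarrow> real"
    let ?h = "\<lambda>y. f (?e (t(a := y))) * ennreal (weight (insert a B) W (?e (t(a := y))))"
    have upd: "?e (t(a := y)) = (?e t)(a := exp y)" for y by auto
    have [measurable]: "(\<lambda>y. f (?e (t(a := y)))) \<in> borel_measurable borel"
      by (rule fm) auto
    have [measurable]: "(\<lambda>y. weight (insert a B) W (?e (t(a := y)))) \<in> borel_measurable borel"
      by (rule borel_measurable_weight) auto
    have h: "?h \<in> borel_measurable borel" by measurable
    have "(\<integral>\<^sup>+y. ?h y \<partial>lborel) = ennreal \<bar>1\<bar> * (\<integral>\<^sup>+s. ?h (ln (?S t) + 1 * s) \<partial>lborel)"
      by (rule nn_integral_real_affine[OF h]) simp
    also have "\<dots> = (\<integral>\<^sup>+s. ?h (ln (?S t) + s) \<partial>lborel)" by simp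
    also have "\<dots> = (\<integral>\<^sup>+s. G s t \<partial>lborel)"
    proof (rule nn_integral_cong)
      fix s
      let ?x = "(?e t)(a := exp s * ?S t)"
      have x: "?e (t(a := ln (?S t) + s)) = ?x"
        using S_pos[of t] unfolding upd by (simp add: exp_add mult.commute)
      have "weight (insert a B) W ?x = eliminated_density ?M (exp s) * weight B (star_mesh W a (exp s)) ?x"
        by (rule weight_star_mesh[OF aB sym]) (use S_pos[of t] aB in \<open>auto simp: star_sum_fun_upd\<close>)
      also have "\<dots> = eliminated_density ?M (exp s) * weight B (star_mesh W a (exp s)) (?e t)"
        by (simp only: weight_fun_upd[OF aB])
      finally show "?h (ln (?S t) + s) = G s t"
        unfolding x by (simp add: G_def ennreal_mult' mult_ac)
    qed
    finally show "(\<integral>\<^sup>+y. ?h y \<partial>lborel) = (\<integral>\<^sup>+s. G s t \<partial>lborel)" .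
  qed
  also have "\<dots> = (\<integral>\<^sup>+s. (\<integral>\<^sup>+t. G s t \<partial>coord_lborel B) \<partial>lborel)"
    by (rule P.Fubini'[OF G_meas])
  also have "\<dots> = (\<integral>\<^sup>+s. ennreal (eliminated_density ?M (exp s)) *
       field_int B (star_mesh W a (exp s)) (\<lambda>x. f (x(a := exp s * star_sum B W a x))) \<partial>lborel)"
  proof (rule nn_integral_cong)
    fix s
    have [measurable]: "(\<lambda>t. f ((?e t)(a := exp s * ?S t))) \<in> borel_measurable (coord_lborel B)"
    proof (rule fm)
      fix i show "(\<lambda>t. ((?e t)(a := exp s * ?S t)) i) \<in> borel_measurable (coord_lborel B)"
        by (cases "i = a") auto
    qed
    have [measurable]: "(\<lambda>t. weight B (star_mesh W a (exp s)) (?e t)) \<in> borel_measurable (coord_lborel B)"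
      by (rule borel_measurable_weight) auto
    show "(\<integral>\<^sup>+t. G s t \<partial>coord_lborel B) = ennreal (eliminated_density ?M (exp s)) *
       field_int B (star_mesh W a (exp s)) (\<lambda>x. f (x(a := exp s * star_sum B W a x)))"
      unfolding G_def field_int_def by (rule nn_integral_cmult) measurable
  qed
  finally show ?thesis .
qed

lemma field_int_empty: "field_int {} W f = f (\<lambda>i. exp undefined)"
proof -
  have "sub_laplacian {} W x = mat 1" for x
    by (auto simp: sub_laplacian_def mat_def vec_eq_iff)
  then have "weight {} W x = 1" for x
    by (simp add: weight_def energy_def)
  then show ?thesis
    by (simp add: field_int_def PiM_empty nn_integral_count_space_finite)
qed

text \<open>When the pin is the only neighbour, the star sum is the constant
  \<open>W (Some k) None\<close>. The eliminated variable then gives the coordinate \<open>k\<close>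
  itself, up to this constant.\<close>

lemma field_int_singleton:
  fixes W :: "'n::finite option \<Rightarrow> 'n option \<Rightarrow> real"
  assumes W: "pos_weights {k} W" and f: "f \<in> borel_measurable fun_borel"
  shows "field_int {k} W f =
    (\<integral>\<^sup>+t. ennreal (ig_density (W (Some k) None) t) * f ((\<lambda>i. exp undefined)(k := exp t)) \<partial>lborel)"
proof -
  have pos: "0 < W (Some k) None" using W by (auto simp: pos_weights_def)
  have "field_int {k} W f = (\<integral>\<^sup>+s. ennreal (eliminated_density (W (Some k) None) (exp s)) *
     f ((\<lambda>i. exp undefined)(k := W (Some k) None * exp s)) \<partial>lborel)"
    using field_int_eliminate[of k "{}" W f] W f
    by (simp add: field_int_empty star_sum_def mult.commute)
  also have "\<dots> = (\<integral>\<^sup>+t. ennreal (ig_density (W (Some k) None) t) * f ((\<lambda>i. exp undefined)(k := exp t)) \<partial>lborel)"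
  proof (rule nn_integral_eliminated_density_shift[OF pos])
    have "(\<lambda>y i. ((\<lambda>i. exp undefined)(k := y)) i) \<in> borel \<rightarrow>\<^sub>M fun_borel"
      by (rule measurable_fun_borelI) auto
    from measurable_compose[OF this f]
    show "(\<lambda>y. f ((\<lambda>i. exp undefined)(k := y))) \<in> borel_measurable borel" by (simp add: fun_upd_def)
  qed
  finally show ?thesis .
qed

section \<open>Convex integrands and pinned edges\<close>

text \<open>Sign and convexity are required on the positive orthant, where the points
  \<open>exp t\<close> lie. Nonnegativity ensures that \<open>ennreal\<close> truncates
  nothing.\<close>

definition convex_test :: "(('n \<Rightarrow> real) \<Rightarrow> real) \<Rightarrow> bool" where
  "convex_test f \<longleftrightarrow> f \<in> borel_measurable fun_borel \<and> (\<forall>x. (\<forall>i. 0 < x i) \<longrightarrow> 0 \<le> f x) \<and>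
     (\<forall>x y u. (\<forall>i. 0 < x i) \<longrightarrow> (\<forall>i. 0 < y i) \<longrightarrow> 0 \<le> u \<longrightarrow> u \<le> 1 \<longrightarrow>
        f (\<lambda>i. (1 - u) * x i + u * y i) \<le> (1 - u) * f x + u * f y)"

lemma convex_testD:
  assumes "convex_test f"
  shows "f \<in> borel_measurable fun_borel"
    and "(\<And>i. 0 < x i) \<Longrightarrow> 0 \<le> f x"
    and "(\<And>i. 0 < x i) \<Longrightarrow> (\<And>i. 0 < y i) \<Longrightarrow> 0 \<le> u \<Longrightarrow> u \<le> 1 \<Longrightarrow>
      f (\<lambda>i. (1 - u) * x i + u * y i) \<le> (1 - u) * f x + u * f y"
  using assms unfolding convex_test_def by blast+

text \<open>The pin enters the star sum with the fixed value 1, so the star sum is affine in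
  \<open>x\<close>. Convexity survives an affine substitution that maps the positive orthant into
  itself.\<close>

lemma convex_test_eliminate:
  assumes f: "convex_test f" and W: "pos_weights (insert a B) W" and aB: "a \<notin> B" and r: "0 < r"
  shows "convex_test (\<lambda>x. f (x(a := r * star_sum B W a x)))"
  unfolding convex_test_def
proof (intro conjI allI impI)
  have S: "(\<lambda>x. star_sum B W a x) \<in> borel_measurable fun_borel"
  proof -
    have [measurable]: "(\<lambda>x. pin_ext x v) \<in> borel_measurable fun_borel" for v
      by (cases v) auto
    show ?thesis unfolding star_sum_def by measurable
  qed
  note [measurable] = this
  have "(\<lambda>x. x(a := r * star_sum B W a x)) \<in> fun_borel \<rightarrow>\<^sub>M fun_borel"
  proof (rule measurable_fun_borelI)
    fix i show "(\<lambda>x. (x(a := r * star_sum B W a x)) i) \<in> borel_measurable fun_borel"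
      by (cases "i = a") auto
  qed
  from measurable_compose[OF this convex_testD(1)[OF f]]
  show "(\<lambda>x. f (x(a := r * star_sum B W a x))) \<in> borel_measurable fun_borel" .
  have pos: "0 < (x(a := r * star_sum B W a x)) i" if "\<forall>i. 0 < x i" for x i
    using that r star_sum_pos[OF W aB, of x] by auto
  show "0 \<le> f (x(a := r * star_sum B W a x))" if "\<forall>i. 0 < x i" for x
    using pos[OF that] by (rule convex_testD(2)[OF f])
  fix x y :: "'a \<Rightarrow> real" and u :: real
  assume x: "\<forall>i. 0 < x i" and y: "\<forall>i. 0 < y i" and u: "0 \<le> u" "u \<le> 1"
  let ?m = "\<lambda>i. (1 - u) * x i + u * y i"
  have e: "pin_ext ?m v = (1 - u) * pin_ext x v + u * pin_ext y v" for v
    by (cases v) auto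
  have Sm: "star_sum B W a ?m = (1 - u) * star_sum B W a x + u * star_sum B W a y"
    unfolding star_sum_def e
    by (simp add: distrib_left sum.distrib sum_distrib_left mult_ac)
  have "?m(a := r * star_sum B W a ?m)
    = (\<lambda>i. (1 - u) * (x(a := r * star_sum B W a x)) i + u * (y(a := r * star_sum B W a y)) i)"
    unfolding Sm by (auto simp: fun_eq_iff algebra_simps)
  then show "f (?m(a := r * star_sum B W a ?m))
     \<le> (1 - u) * f (x(a := r * star_sum B W a x)) + u * f (y(a := r * star_sum B W a y))"
    by (simp only:) (rule convex_testD(3)[OF f pos[OF x] pos[OF y] u])
qed

lemma pos_weights_star_mesh:
  assumes W: "pos_weights (insert a B) W" and aB: "a \<notin> B" and r: "0 < r"
  shows "pos_weights B (star_mesh W a r)"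
proof -
  have "W u v = W v u" if "u \<in> pin_set B" "v \<in> pin_set B" for u v
    using W that unfolding pos_weights_def by (intro symmetric_weightsD[of "insert a B" W]) auto
  then have "symmetric_weights B (star_mesh W a r)"
    unfolding symmetric_weights_def star_mesh_def by (simp add: mult_ac)
  moreover have "0 < star_mesh W a r u v" if "u \<in> pin_set B" "v \<in> pin_set B" "u \<noteq> v" for u v
  proof -
    have "Some a \<noteq> u" "Some a \<noteq> v" using aB that by auto
    then have "0 < W u v" "0 < W (Some a) u" "0 < W (Some a) v"
      using W that unfolding pos_weights_def by auto
    with r show ?thesis by (simp add: star_mesh_def add_pos_pos)
  qed
  ultimately show ?thesis by (simp add: pos_weights_def)
qed

lemma pos_weights_sum_pos:
  fixes W :: "'n::finite option \<Rightarrow> 'n option \<Rightarrow> real"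
  assumes "pos_weights (insert a B) W" "a \<notin> B"
  shows "0 < (\<Sum>v\<in>pin_set B. W (Some a) v)"
proof -
  have "pin_ext (\<lambda>_. 1) v = 1" for v :: "'n option" by (cases v) auto
  then show ?thesis using star_sum_pos[OF assms, of "\<lambda>_. 1"] by (simp add: star_sum_def)
qed

lemma pos_weights_set_weight:
  assumes "pos_weights A W" "0 < w"
  shows "pos_weights A (set_weight W u v w)"
  using assms unfolding pos_weights_def symmetric_weights_def set_weight_def
  by (simp add: insert_commute)

text \<open>All vertices but \<open>k\<close> are eliminated. Each elimination averages over a
  probability law in \<open>s\<close>, and at \<open>{k}\<close> the inverse Gaussian law has mass
  and mean 1.\<close>

lemma field_int_mass_mean:
  fixes W :: "'n::finite option \<Rightarrow> 'n option \<Rightarrow> real"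
  assumes "k \<notin> B" "pos_weights (insert k B) W"
  shows "field_int (insert k B) W (\<lambda>_. 1) = 1 \<and> field_int (insert k B) W (\<lambda>x. ennreal (x k)) = 1"
  using finite[of B] assms
proof (induction B arbitrary: W)
  case empty
  then have pos: "0 < W (Some k) None" by (auto simp: pos_weights_def)
  have "(\<lambda>x. ennreal (x k)) \<in> borel_measurable fun_borel" by measurable
  then show ?case using empty nn_integral_ig_density[OF pos] nn_integral_ig_density_reflect[of "W (Some k) None"] pos
    by (simp add: field_int_singleton ennreal_mult[symmetric] mult.commute)
next
  case (insert a B)
  let ?A = "insert k B"
  have a: "a \<notin> ?A" using insert by auto
  have W: "pos_weights (insert a ?A) W" using insert.prems by (simp add: insert_commute)
  have IH: "field_int ?A (star_mesh W a (exp s)) (\<lambda>_. 1) = 1 \<and>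
      field_int ?A (star_mesh W a (exp s)) (\<lambda>x. ennreal (x k)) = 1" for s
    using insert.prems by (intro insert.IH pos_weights_star_mesh[OF W a]) auto
  have meas: "(\<lambda>x. ennreal (x k)) \<in> borel_measurable fun_borel" by measurable
  \<comment> \<open>The substitution at \<open>a\<close> does not touch the coordinate
    \<open>k\<close>, so both integrands keep their form.\<close>
  have "k \<noteq> a" using a by auto
  then have "field_int (insert a ?A) W (\<lambda>_. 1) = 1 \<and> field_int (insert a ?A) W (\<lambda>x. ennreal (x k)) = 1"
    using IH nn_integral_eliminated_density[OF pos_weights_sum_pos[OF W a]]
    by (simp add: field_int_eliminate[OF a W] meas del: pin_set_simps)
  then show ?case by (simp add: insert_commute)
qed

text \<open>Let \<open>a\<close> lie outside \<open>K\<close>. The edge \<open>{u, v}\<close> does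
  not meet \<open>a\<close>, so neither the law of \<open>s\<close> nor the substituted integrand
  depends on its weight. The star-mesh step adds the same amount to \<open>w\<close> and
  \<open>w'\<close>, hence their order persists for each \<open>s\<close> until only
  \<open>K\<close> is left.\<close>

lemma field_int_antimono_reduce:
  fixes K :: "'n::finite set"
  assumes base: "\<And>W f w w'. pos_weights K W \<Longrightarrow> convex_test f \<Longrightarrow> 0 < w \<Longrightarrow> w \<le> w' \<Longrightarrow>
      field_int K (set_weight W u v w') (\<lambda>x. ennreal (f x)) \<le> field_int K (set_weight W u v w) (\<lambda>x. ennreal (f x))"
    and uv: "u \<in> pin_set K" "v \<in> pin_set K" "u \<noteq> v"
    and disj: "B \<inter> K = {}" and W: "pos_weights (B \<union> K) W" and f: "convex_test f" and w: "0 < w" "w \<le> w'"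
  shows "field_int (B \<union> K) (set_weight W u v w') (\<lambda>x. ennreal (f x))
    \<le> field_int (B \<union> K) (set_weight W u v w) (\<lambda>x. ennreal (f x))"
  using finite[of B] disj W f w
proof (induction B arbitrary: W f w w')
  case empty
  then show ?case using base by simp
next
  case (insert a B)
  let ?A = "B \<union> K"
  have a: "a \<notin> ?A" using insert by auto
  then have au: "Some a \<noteq> u" "Some a \<noteq> v" using uv by auto
  have W: "pos_weights (insert a ?A) W" using insert.prems by simp
  have row: "set_weight W u v z (Some a) y = W (Some a) y" for y z
    using au by (auto simp: set_weight_def doubleton_eq_iff)
  have mesh: "star_mesh (set_weight W u v z) a r
      = set_weight (star_mesh W a r) u v (z + r * W (Some a) u * W (Some a) v)" for z r
  proof (intro ext)
    fix x y
    show "star_mesh (set_weight W u v z) a r x y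
      = set_weight (star_mesh W a r) u v (z + r * W (Some a) u * W (Some a) v) x y"
    proof (cases "{x, y} = {u, v}")
      case True
      then have "r * W (Some a) x * W (Some a) y = r * W (Some a) u * W (Some a) v"
        by (auto simp: doubleton_eq_iff)
      with True show ?thesis unfolding star_mesh_def row by (simp add: set_weight_def)
    next
      case False
      then show ?thesis unfolding star_mesh_def row by (simp add: set_weight_def)
    qed
  qed
  have fm: "(\<lambda>x. ennreal (f x)) \<in> borel_measurable fun_borel"
    using convex_testD(1)[OF insert.prems(3)] by measurable
  have elim: "field_int (insert a ?A) (set_weight W u v z) (\<lambda>x. ennreal (f x)) =
      (\<integral>\<^sup>+s. ennreal (eliminated_density (\<Sum>y\<in>pin_set ?A. W (Some a) y) (exp s)) *
        field_int ?A (set_weight (star_mesh W a (exp s)) u v (z + exp s * W (Some a) u * W (Some a) v))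
          (\<lambda>x. ennreal (f (x(a := exp s * star_sum ?A W a x)))) \<partial>lborel)" if "0 < z" for z
  proof -
    have "star_sum ?A (set_weight W u v z) a x = star_sum ?A W a x" for x
      by (simp add: star_sum_def row)
    then show ?thesis
      using field_int_eliminate[OF a pos_weights_set_weight[OF W that] fm, of u v]
      by (simp add: mesh row)
  qed
  have "field_int (insert a ?A) (set_weight W u v w') (\<lambda>x. ennreal (f x))
     \<le> field_int (insert a ?A) (set_weight W u v w) (\<lambda>x. ennreal (f x))"
  proof -
    have w': "0 < w'" using insert.prems by simp
    have Wpos: "0 < W (Some a) u" "0 < W (Some a) v"
      using W uv au unfolding pos_weights_def by (auto simp: pin_set_def)
    show ?thesis unfolding elim[OF w'] elim[OF insert.prems(4)]
    proof (intro nn_integral_mono mult_left_mono insert.IH)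
      fix s :: real
      show "B \<inter> K = {}" using insert.prems by auto
      show "pos_weights ?A (star_mesh W a (exp s))" by (rule pos_weights_star_mesh[OF W a]) simp
      show "convex_test (\<lambda>x. f (x(a := exp s * star_sum ?A W a x)))"
        by (rule convex_test_eliminate[OF insert.prems(3) W a]) simp
      show "0 < w + exp s * W (Some a) u * W (Some a) v"
        using Wpos insert.prems by (simp add: add_pos_pos)
      show "w + exp s * W (Some a) u * W (Some a) v \<le> w' + exp s * W (Some a) u * W (Some a) v"
        using insert.prems by simp
    qed simp
  qed
  then show ?case by simp
qed

lemma field_int_antimono_pinned_edge:
  fixes W :: "'n::finite option \<Rightarrow> 'n option \<Rightarrow> real"
  assumes k: "k \<notin> B" and W: "pos_weights (insert k B) W" and f: "convex_test f" and w: "0 < w" "w \<le> w'"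
  shows "field_int (insert k B) (set_weight W None (Some k) w') (\<lambda>x. ennreal (f x))
    \<le> field_int (insert k B) (set_weight W None (Some k) w) (\<lambda>x. ennreal (f x))"
proof -
  have "field_int (B \<union> {k}) (set_weight W None (Some k) w') (\<lambda>x. ennreal (f x))
    \<le> field_int (B \<union> {k}) (set_weight W None (Some k) w) (\<lambda>x. ennreal (f x))"
  proof (rule field_int_antimono_reduce)
    fix W :: "'n option \<Rightarrow> 'n option \<Rightarrow> real" and f :: "('n \<Rightarrow> real) \<Rightarrow> real" and w w'
    assume W: "pos_weights {k} W" and f: "convex_test f" and w: "0 < w" "w \<le> (w' :: real)"
    let ?x = "\<lambda>y :: real. (\<lambda>i. exp undefined)(k := y)"
    have fm: "(\<lambda>x. ennreal (f x)) \<in> borel_measurable fun_borel"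
      using convex_testD(1)[OF f] by measurable
    have pos: "0 < y \<Longrightarrow> 0 < ?x y i" for y i by simp
    have conv: "convex_on {0<..} (\<lambda>y. f (?x y))"
    proof (rule convex_onI)
      fix u x y :: real assume u: "0 < u" "u < 1" and xy: "x \<in> {0<..}" "y \<in> {0<..}"
      have "?x ((1 - u) *\<^sub>R x + u *\<^sub>R y) = (\<lambda>i. (1 - u) * ?x x i + u * ?x y i)"
        by (auto simp: algebra_simps)
      then show "f (?x ((1 - u) *\<^sub>R x + u *\<^sub>R y)) \<le> (1 - u) * f (?x x) + u * f (?x y)"
        using convex_testD(3)[OF f, of "?x x" "?x y" u] pos xy u by simp
    qed simp
    have meas: "(\<lambda>t. f (?x (exp t))) \<in> borel_measurable borel"
    proof -
      have "(\<lambda>t i. ?x (exp t) i) \<in> borel \<rightarrow>\<^sub>M fun_borel"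
        by (rule measurable_fun_borelI) auto
      from measurable_compose[OF this convex_testD(1)[OF f]] show ?thesis by (simp add: fun_upd_def)
    qed
    have nonneg: "0 \<le> f (?x y)" if "0 < y" for y
      using pos[OF that] by (rule convex_testD(2)[OF f])
    have "(\<integral>\<^sup>+t. ennreal (f (?x (exp t)) * ig_density w' t) \<partial>lborel)
      \<le> (\<integral>\<^sup>+t. ennreal (f (?x (exp t)) * ig_density w t) \<partial>lborel)"
      by (rule ig_convex_order[OF w conv nonneg meas])
    moreover have "field_int {k} (set_weight W None (Some k) z) (\<lambda>x. ennreal (f x))
      = (\<integral>\<^sup>+t. ennreal (f (?x (exp t)) * ig_density z t) \<partial>lborel)" if "0 < z" for z
    proof -
      have "set_weight W None (Some k) z (Some k) None = z" by (auto simp: set_weight_def)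
      then show ?thesis
        using that by (simp add: field_int_singleton[OF pos_weights_set_weight[OF W that] fm]
          ennreal_mult'[symmetric] mult.commute)
    qed
    ultimately show "field_int {k} (set_weight W None (Some k) w') (\<lambda>x. ennreal (f x))
      \<le> field_int {k} (set_weight W None (Some k) w) (\<lambda>x. ennreal (f x))"
      using w by simp
  qed (use assms in auto)
  then show ?thesis by simp
qed

section \<open>Change of the pinning point\<close>

text \<open>The involution exchanging the pin and \<open>p\<close>. Composing the weights with it
  expresses pinning at \<open>p\<close> without changing the index type.\<close>

definition swap_pin :: "'n \<Rightarrow> 'n option \<Rightarrow> 'n option" where
  "swap_pin p u = (if u = None then Some p else if u = Some p then None else u)"

lemma swap_pin_simps [simp]:
  "swap_pin p None = Some p" "swap_pin p (Some p) = None" "q \<noteq> p \<Longrightarrow> swap_pin p (Some q) = Some q"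
  "swap_pin p (swap_pin p u) = u"
  by (auto simp: swap_pin_def)

lemma inj_swap_pin: "inj (swap_pin p)"
  by (metis injI swap_pin_simps(4))

lemma swap_pin_pin_set: "p \<in> A \<Longrightarrow> u \<in> pin_set A \<Longrightarrow> swap_pin p u \<in> pin_set A"
  by (auto simp: swap_pin_def pin_set_def)

text \<open>Two eliminations in a row. The three summands, multiplied by the prefactor, are the
  spanning trees of the triangle on the pin, \<open>p\<close> and \<open>q\<close>.\<close>

lemma det_sub_laplacian_pair:
  fixes W :: "'n::finite option \<Rightarrow> 'n option \<Rightarrow> real"
  assumes pq: "p \<noteq> q" and W: "pos_weights {p, q} W" and x: "\<And>i. 0 < x i"
  shows "det (sub_laplacian {p, q} W x) = x p * x q *
    (W (Some p) None * W (Some q) None + W (Some p) None * W (Some p) (Some q) * x p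
      + W (Some q) None * W (Some p) (Some q) * x q)"
proof -
  let ?A = "W (Some p) None" and ?B = "W (Some q) None" and ?C = "W (Some p) (Some q)"
  have S: "0 < star_sum {q} W p x" using star_sum_pos[of p "{q}" W x] W pq x by simp
  have Se: "star_sum {q} W p x = ?A + ?C * x q" by (simp add: star_sum_def)
  define r where "r = x p / star_sum {q} W p x"
  have r: "0 < r" using S x by (simp add: r_def)
  let ?W = "star_mesh W p r"
  have W2: "pos_weights {q} ?W" using pos_weights_star_mesh[of p "{q}" W r] W pq r by simp
  have S2: "0 < star_sum {} ?W q x" using star_sum_pos[of q "{}" ?W x] W2 x by simp
  have "det (sub_laplacian {p, q} W x) = x p * star_sum {q} W p x * det (sub_laplacian {q} ?W x)"
    using W pq S by (intro det_star_mesh) (auto simp: pos_weights_def r_def)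
  also have "det (sub_laplacian {q} ?W x) = x q * star_sum {} ?W q x *
      det (sub_laplacian {} (star_mesh ?W q (x q / star_sum {} ?W q x)) x)"
    using W2 S2 by (intro det_star_mesh) (auto simp: pos_weights_def)
  also have "sub_laplacian {} (star_mesh ?W q (x q / star_sum {} ?W q x)) x = mat 1"
    by (auto simp: sub_laplacian_def mat_def vec_eq_iff)
  also have "star_sum {} ?W q x = ?B + r * ?C * ?A"
    by (simp add: star_sum_def star_mesh_def)
  also have "x p * star_sum {q} W p x * (x q * (?B + r * ?C * ?A) * det (mat 1 :: real^'n^'n))
      = x p * x q * (star_sum {q} W p x * ?B + x p * ?C * ?A)"
    using S by (simp add: r_def field_simps)
  finally show ?thesis unfolding Se by (simp add: algebra_simps)
qed

text \<open>The energy depends on ratios only. Each tree of the triangle has two edges, so dividing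
  all vertex values by \<open>x p\<close> divides the determinant by the fourth power of
  \<open>x p\<close> and its root by the square. The factors \<open>1 / y i\<close> gain a third
  power, and one factor \<open>x p\<close> remains.\<close>

lemma weight_swap_pin:
  fixes W :: "'n::finite option \<Rightarrow> 'n option \<Rightarrow> real"
  assumes pq: "p \<noteq> q" and W: "pos_weights {p, q} W"
    and W': "pos_weights {p, q} (\<lambda>a b. W (swap_pin p a) (swap_pin p b))"
    and x: "\<And>i. 0 < x i" and y: "\<And>i. 0 < y i" and yp: "y p = 1 / x p" and yq: "y q = x q / x p"
  shows "weight {p, q} W y = x p * weight {p, q} (\<lambda>a b. W (swap_pin p a) (swap_pin p b)) x"
proof -
  let ?W = "\<lambda>a b. W (swap_pin p a) (swap_pin p b)"
  have sym: "W None (Some p) = W (Some p) None" "W None (Some q) = W (Some q) None"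
    "W (Some q) (Some p) = W (Some p) (Some q)"
    using W pq unfolding pos_weights_def by (auto intro!: symmetric_weightsD[of "{p, q}" W])
  have xp: "0 < x p" and xq: "0 < x q" using x by auto
  have E: "energy {p, q} W y = energy {p, q} ?W x"
    using pq xp xq by (simp add: energy_def sym yp yq field_simps)
  have "det (sub_laplacian {p, q} W y) = det (sub_laplacian {p, q} ?W x) / x p ^ 4"
    unfolding det_sub_laplacian_pair[OF pq W y] det_sub_laplacian_pair[OF pq W' x]
    using pq xp by (simp add: sym yp yq field_simps power_numeral_reduce)
  then have D: "sqrt (det (sub_laplacian {p, q} W y)) = sqrt (det (sub_laplacian {p, q} ?W x)) / (x p)\<^sup>2"
  proof -
    have "sqrt (x p ^ 4) = (x p)\<^sup>2"
      by (rule real_sqrt_unique) (simp_all flip: power_mult)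
    with \<open>det (sub_laplacian {p, q} W y) = _\<close> show ?thesis by (simp add: real_sqrt_divide)
  qed
  show ?thesis unfolding weight_def E D using pq xp xq
    by (simp add: yp yq field_simps power2_eq_square)
qed

text \<open>
  Points of the product space over \<open>{p, q}\<close> take the value \<open>undefined\<close> at all other indices, which
  is why \<open>exp undefined\<close> appears as the remaining coordinates.
\<close>

definition pin_perspective :: "'n \<Rightarrow> 'n \<Rightarrow> (('n \<Rightarrow> real) \<Rightarrow> real) \<Rightarrow> ('n \<Rightarrow> real) \<Rightarrow> real" where
  "pin_perspective p q f x =
     x p * f (\<lambda>l. if l = p then 1 / x p else if l = q then x q / x p else exp undefined)"

lemma borel_measurable_pin_perspective:
  assumes "f \<in> borel_measurable fun_borel"
  shows "pin_perspective p q f \<in> borel_measurable fun_borel"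
proof -
  have "(\<lambda>x l. if l = p then 1 / x p else if l = q then x q / x p else exp undefined) \<in> fun_borel \<rightarrow>\<^sub>M fun_borel"
    by (rule measurable_fun_borelI) auto
  from measurable_compose[OF this assms] show ?thesis
    unfolding pin_perspective_def by measurable
qed

lemma convex_test_pin_perspective:
  assumes f: "convex_test f"
  shows "convex_test (pin_perspective p q f)"
  unfolding convex_test_def
proof (intro conjI allI impI)
  show "pin_perspective p q f \<in> borel_measurable fun_borel"
    using convex_testD(1)[OF f] by (rule borel_measurable_pin_perspective)
  let ?g = "\<lambda>x l. if l = p then 1 / x p else if l = q then x q / x p else exp undefined :: real"
  have pos: "0 < ?g x l" if "\<forall>i. 0 < x i" for x l using that by auto
  show "0 \<le> pin_perspective p q f x" if "\<forall>i. 0 < x i" for x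
    unfolding pin_perspective_def
    by (intro mult_nonneg_nonneg convex_testD(2)[OF f] pos[OF that]) (use that in \<open>auto intro: less_imp_le\<close>)
  fix x y :: "'a \<Rightarrow> real" and u :: real
  assume x: "\<forall>i. 0 < x i" and y: "\<forall>i. 0 < y i" and u: "0 \<le> u" "u \<le> 1"
  let ?m = "\<lambda>i. (1 - u) * x i + u * y i"
  have xy: "0 < x p" "0 < y p" using x y by auto
  have m: "0 < ?m p"
  proof (cases "u = 0")
    case False
    then show ?thesis using u xy by (intro add_nonneg_pos) auto
  qed (use xy in simp)
  \<comment> \<open>Dividing the mixture by its own \<open>p\<close> coordinate turns it into a
    mixture of the two normalized points. Their shares are proportional to
    \<open>(1 - u) * x p\<close> and \<open>u * y p\<close>.\<close>
  define \<theta> where "\<theta> = u * y p / ?m p"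
  have th1: "1 - \<theta> = (1 - u) * x p / ?m p" using m by (simp add: \<theta>_def field_simps)
  have "0 \<le> \<theta>" using u xy m by (simp add: \<theta>_def)
  moreover have "0 \<le> 1 - \<theta>" unfolding th1 using u xy m by simp
  ultimately have th: "0 \<le> \<theta>" "\<theta> \<le> 1" by auto
  have "?g ?m = (\<lambda>l. (1 - \<theta>) * ?g x l + \<theta> * ?g y l)"
  proof
    fix l
    consider "l = p" | "l \<noteq> p" "l = q" | "l \<noteq> p" "l \<noteq> q" by blast
    then show "?g ?m l = (1 - \<theta>) * ?g x l + \<theta> * ?g y l"
    proof cases
      case 1
      then show ?thesis unfolding th1 unfolding \<theta>_def using xy m by (simp add: add_divide_distrib[symmetric])
    next
      case 2
      then show ?thesis unfolding th1 unfolding \<theta>_def using xy m by (simp add: add_divide_distrib[symmetric])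
    next
      case 3
      then show ?thesis by (simp add: algebra_simps)
    qed
  qed
  then have "f (?g ?m) \<le> (1 - \<theta>) * f (?g x) + \<theta> * f (?g y)"
    using convex_testD(3)[OF f pos[OF x] pos[OF y] th] by simp
  then have "?m p * f (?g ?m) \<le> ?m p * ((1 - \<theta>) * f (?g x) + \<theta> * f (?g y))"
    using m by (intro mult_left_mono) auto
  also have "\<dots> = (?m p * (1 - \<theta>)) * f (?g x) + (?m p * \<theta>) * f (?g y)"
    by (simp add: distrib_left mult.assoc)
  also have "\<dots> = ((1 - u) * x p) * f (?g x) + (u * y p) * f (?g y)"
    unfolding th1 unfolding \<theta>_def using m by simp
  finally show "pin_perspective p q f ?m \<le> (1 - u) * pin_perspective p q f x + u * pin_perspective p q f y"
    by (simp add: pin_perspective_def mult.assoc)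
qed

section \<open>Two-vertex integrals under a change of pin\<close>

definition pair_point :: "'n \<Rightarrow> 'n \<Rightarrow> real \<Rightarrow> real \<Rightarrow> 'n \<Rightarrow> real" where
  "pair_point p q a b l = (if l = p then exp a else if l = q then exp b else exp undefined)"

lemma measurable_pair_point:
  assumes [measurable]: "g \<in> borel_measurable fun_borel" "a \<in> borel_measurable M" "b \<in> borel_measurable M"
  shows "(\<lambda>z. g (pair_point p q (a z) (b z))) \<in> borel_measurable M"
proof -
  have "(\<lambda>z. pair_point p q (a z) (b z)) \<in> M \<rightarrow>\<^sub>M fun_borel"
    by (rule measurable_fun_borelI) (auto simp: pair_point_def)
  from measurable_compose[OF this assms(1)] show ?thesis .
qed

lemma borel_measurable_weight_fun_borel: "weight A W \<in> borel_measurable fun_borel"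
  by (rule borel_measurable_weight) auto

lemma field_int_pair:
  fixes W :: "'n::finite option \<Rightarrow> 'n option \<Rightarrow> real"
  assumes pq: "p \<noteq> q" and g: "g \<in> borel_measurable fun_borel"
  shows "field_int {p, q} W g = (\<integral>\<^sup>+a. \<integral>\<^sup>+b. g (pair_point p q a b) * ennreal (weight {p, q} W (pair_point p q a b)) \<partial>lborel \<partial>lborel)"
proof -
  interpret product_sigma_finite "\<lambda>_::'n. lborel :: real measure" by standard
  let ?H = "\<lambda>a b. g (pair_point p q a b) * ennreal (weight {p, q} W (pair_point p q a b))"
  note [measurable] = measurable_pair_point[OF g] measurable_pair_point[OF borel_measurable_weight_fun_borel]
  have H: "case_prod ?H \<in> borel_measurable (lborel \<Otimes>\<^sub>M lborel)"
    unfolding case_prod_beta by measurable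
  have "field_int {p, q} W g = (\<integral>\<^sup>+t. ?H (t p) (t q) \<partial>coord_lborel {p, q})"
    unfolding field_int_def
  proof (rule nn_integral_cong)
    fix t :: "'n \<Rightarrow> real" assume "t \<in> space (coord_lborel {p, q})"
    then have "(\<lambda>i. exp (t i)) = pair_point p q (t p) (t q)"
      by (auto simp: fun_eq_iff pair_point_def space_PiM PiE_def extensional_def)
    then show "g (\<lambda>i. exp (t i)) * ennreal (weight {p, q} W (\<lambda>i. exp (t i))) = ?H (t p) (t q)"
      by simp
  qed
  also have "\<dots> = (\<integral>\<^sup>+z. ?H (fst z) (snd z) \<partial>(lborel \<Otimes>\<^sub>M lborel))"
    using H pq by (rule product_nn_integral_pair)
  also have "\<dots> = (\<integral>\<^sup>+a. \<integral>\<^sup>+b. ?H a b \<partial>lborel \<partial>lborel)"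
    using lborel.nn_integral_fst[OF H] by (simp add: case_prod_unfold)
  finally show ?thesis .
qed

lemma pos_weights_swap_pin:
  assumes "pos_weights A W" "p \<in> A"
  shows "pos_weights A (\<lambda>a b. W (swap_pin p a) (swap_pin p b))"
  using assms swap_pin_pin_set[OF assms(2)] inj_swap_pin[of p]
  unfolding pos_weights_def symmetric_weights_def by (simp add: inj_eq)

text \<open>
  Moving the pin from \<open>\<delta>\<close> to \<open>p\<close> multiplies the measure by \<open>exp (t\<^sub>p)\<close>, which is exactly the
  factor that turns \<open>f\<close> into its perspective.
\<close>

lemma field_int_swap_pin:
  fixes W :: "'n::finite option \<Rightarrow> 'n option \<Rightarrow> real"
  assumes pq: "p \<noteq> q" and W: "pos_weights {p, q} W" and f: "f \<in> borel_measurable fun_borel"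
  shows "field_int {p, q} W (\<lambda>x. ennreal (f x)) =
    field_int {p, q} (\<lambda>a b. W (swap_pin p a) (swap_pin p b)) (\<lambda>x. ennreal (pin_perspective p q f x))"
proof -
  let ?W = "\<lambda>a b. W (swap_pin p a) (swap_pin p b)"
  have W': "pos_weights {p, q} ?W" using W by (rule pos_weights_swap_pin) simp
  have fm: "(\<lambda>x. ennreal (f x)) \<in> borel_measurable fun_borel"
    and fm': "(\<lambda>x. ennreal (pin_perspective p q f x)) \<in> borel_measurable fun_borel"
    using f borel_measurable_pin_perspective[OF f, of p q] by measurable
  let ?H = "\<lambda>a b. ennreal (f (pair_point p q a b)) * ennreal (weight {p, q} W (pair_point p q a b))"
  note [measurable] = measurable_pair_point[OF f] measurable_pair_point[OF borel_measurable_weight_fun_borel]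
  have H: "case_prod ?H \<in> borel_measurable (borel \<Otimes>\<^sub>M lborel)"
    unfolding case_prod_beta by measurable
  have "field_int {p, q} W (\<lambda>x. ennreal (f x)) = (\<integral>\<^sup>+a. \<integral>\<^sup>+b. ?H a b \<partial>lborel \<partial>lborel)"
    by (rule field_int_pair[OF pq fm])
  \<comment> \<open>Logarithmic coordinates relative to the new pin: \<open>a = - u\<close> and
    \<open>b = v - u\<close>, a measure-preserving change made one variable at a time.\<close>
  also have "\<dots> = ennreal \<bar>-1\<bar> * (\<integral>\<^sup>+u. \<integral>\<^sup>+b. ?H (0 + -1 * u) b \<partial>lborel \<partial>lborel)"
    using lborel.borel_measurable_nn_integral_fst[OF H]
    by (intro nn_integral_real_affine) auto
  also have "\<dots> = (\<integral>\<^sup>+u. \<integral>\<^sup>+b. ?H (- u) b \<partial>lborel \<partial>lborel)" by simp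
  also have "\<dots> = (\<integral>\<^sup>+u. ennreal \<bar>1\<bar> * (\<integral>\<^sup>+v. ?H (- u) (- u + 1 * v) \<partial>lborel) \<partial>lborel)"
    by (intro nn_integral_cong nn_integral_real_affine) measurable
  also have "\<dots> = (\<integral>\<^sup>+u. \<integral>\<^sup>+v. ennreal (pin_perspective p q f (pair_point p q u v)) *
      ennreal (weight {p, q} ?W (pair_point p q u v)) \<partial>lborel \<partial>lborel)"
  proof -
    have "?H (- u) (- u + 1 * v) = ennreal (pin_perspective p q f (pair_point p q u v)) *
      ennreal (weight {p, q} ?W (pair_point p q u v))" for u v
    proof -
      let ?x = "pair_point p q u v" and ?y = "pair_point p q (- u) (- u + v)"
      have y: "?y = (\<lambda>l. if l = p then 1 / ?x p else if l = q then ?x q / ?x p else exp undefined)"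
        using pq by (auto simp: pair_point_def exp_diff exp_minus inverse_eq_divide)
      have "weight {p, q} W ?y = ?x p * weight {p, q} ?W ?x"
        by (rule weight_swap_pin[OF pq W W'])
          (use pq in \<open>auto simp: pair_point_def exp_diff exp_minus inverse_eq_divide\<close>)
      moreover have "0 < ?x p" by (simp add: pair_point_def)
      moreover have "pin_perspective p q f ?x = ?x p * f ?y"
        unfolding pin_perspective_def y ..
      ultimately show ?thesis by (simp add: ennreal_mult' mult_ac)
    qed
    then show ?thesis by simp
  qed
  also have "\<dots> = field_int {p, q} ?W (\<lambda>x. ennreal (pin_perspective p q f x))"
    by (rule field_int_pair[OF pq fm', symmetric])
  finally show ?thesis .
qed

lemma field_int_antimono:
  fixes W :: "'n::finite option \<Rightarrow> 'n option \<Rightarrow> real"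
  assumes W: "pos_weights UNIV W" and f: "convex_test f" and uv: "u \<noteq> v" and w: "0 < w" "w \<le> w'"
  shows "field_int UNIV (set_weight W u v w') (\<lambda>x. ennreal (f x))
    \<le> field_int UNIV (set_weight W u v w) (\<lambda>x. ennreal (f x))"
proof -
  have pinned: "field_int UNIV (set_weight W None (Some k) w') (\<lambda>x. ennreal (f x))
    \<le> field_int UNIV (set_weight W None (Some k) w) (\<lambda>x. ennreal (f x))" for k
    using field_int_antimono_pinned_edge[of k "UNIV - {k}" W f w w'] W f w
    by (simp add: insert_Diff_if)
  have comm: "set_weight W a b z = set_weight W b a z" for a b z
    by (simp add: set_weight_def insert_commute)
  consider k where "u = None" "v = Some k" | k where "u = Some k" "v = None"
    | p q where "u = Some p" "v = Some q" "p \<noteq> q"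
    using uv by (cases u; cases v) auto
  then show ?thesis
  proof cases
    case 1
    then show ?thesis using pinned by simp
  next
    case 2
    then show ?thesis using pinned comm by metis
  next
    case 3
    have "(UNIV - {p, q}) \<union> {p, q} = UNIV" by auto
    with W have WU: "pos_weights ((UNIV - {p, q}) \<union> {p, q}) W" by (simp only:)
    have "field_int ((UNIV - {p, q}) \<union> {p, q}) (set_weight W u v w') (\<lambda>x. ennreal (f x))
      \<le> field_int ((UNIV - {p, q}) \<union> {p, q}) (set_weight W u v w) (\<lambda>x. ennreal (f x))"
    proof (rule field_int_antimono_reduce)
      fix W :: "'n option \<Rightarrow> 'n option \<Rightarrow> real" and f :: "('n \<Rightarrow> real) \<Rightarrow> real" and w w' :: real
      assume W: "pos_weights {p, q} W" and f: "convex_test f" and w: "0 < w" "w \<le> w'"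
      let ?W = "\<lambda>a b. W (swap_pin p a) (swap_pin p b)"
      \<comment> \<open>After the exchange, the edge \<open>{p, q}\<close> joins the pin to
        \<open>q\<close>, so the result for pinned edges applies.\<close>
      have swap: "(\<lambda>a b. set_weight W u v z (swap_pin p a) (swap_pin p b)) = set_weight ?W None (Some q) z" for z
      proof -
        have "{swap_pin p a, swap_pin p b} = {u, v} \<longleftrightarrow> {a, b} = {None, Some q}" for a b
          unfolding 3 using 3 by (auto simp: swap_pin_def doubleton_eq_iff split: if_splits)
        then show ?thesis by (simp add: set_weight_def)
      qed
      have eq: "field_int {p, q} (set_weight W u v z) (\<lambda>x. ennreal (f x))
        = field_int {p, q} (set_weight ?W None (Some q) z) (\<lambda>x. ennreal (pin_perspective p q f x))" if "0 < z" for z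
        using field_int_swap_pin[OF 3(3) pos_weights_set_weight[OF W that] convex_testD(1)[OF f], of u v]
        unfolding swap .
      have "field_int (insert q {p}) (set_weight ?W None (Some q) w') (\<lambda>x. ennreal (pin_perspective p q f x))
        \<le> field_int (insert q {p}) (set_weight ?W None (Some q) w) (\<lambda>x. ennreal (pin_perspective p q f x))"
        using 3 W w pos_weights_swap_pin[OF W, of p]
        by (intro field_int_antimono_pinned_edge convex_test_pin_perspective[OF f]) (auto simp: insert_commute)
      then show "field_int {p, q} (set_weight W u v w') (\<lambda>x. ennreal (f x))
        \<le> field_int {p, q} (set_weight W u v w) (\<lambda>x. ennreal (f x))"
        using eq w by (simp add: insert_commute)
    qed (use 3 WU f w in auto)
    then show ?thesis using \<open>(UNIV - {p, q}) \<union> {p, q} = UNIV\<close> by (simp only:)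
  qed
qed

section \<open>The effective field on Euclidean space\<close>

text \<open>Lebesgue measure is determined by its values on boxes, and the image of the product
  measure has the same values.\<close>

lemma nn_integral_lborel_vec:
  fixes g :: "real^'n::finite \<Rightarrow> ennreal"
  assumes g: "g \<in> borel_measurable borel"
  shows "(\<integral>\<^sup>+t. g t \<partial>lborel) = (\<integral>\<^sup>+t. g (\<chi> i. t i) \<partial>coord_lborel UNIV)"
proof -
  interpret product_sigma_finite "\<lambda>_::'n. lborel :: real measure" by standard
  have meas: "(\<lambda>t. \<chi> i. t i) \<in> coord_lborel UNIV \<rightarrow>\<^sub>M (borel :: (real^'n) measure)"
    by (subst borel_measurable_euclidean_space) (auto simp: Basis_vec_def inner_axis)
  have "lborel = distr (coord_lborel UNIV) borel (\<lambda>t. \<chi> i::'n. t i)"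
  proof (rule lborel_eqI)
    fix l u :: "real^'n"
    assume le: "\<And>b. b \<in> Basis \<Longrightarrow> l \<bullet> b \<le> u \<bullet> b"
    have lu: "l $ i \<le> u $ i" for i
      using le[of "axis i 1"] by (simp add: axis_in_Basis_iff inner_axis)
    have "(\<lambda>t. \<chi> i. t i) -` box l u \<inter> space (coord_lborel UNIV) = (\<Pi>\<^sub>E i\<in>UNIV. {l $ i <..< u $ i})"
      by (auto simp: mem_box_cart space_PiM PiE_iff)
    then have "emeasure (distr (coord_lborel UNIV) borel (\<lambda>t. \<chi> i::'n. t i)) (box l u)
      = emeasure (coord_lborel UNIV) (\<Pi>\<^sub>E i\<in>UNIV. {l $ i <..< u $ i})"
      using meas by (simp add: emeasure_distr)
    also have "\<dots> = (\<Prod>i\<in>UNIV. emeasure lborel {l $ i <..< u $ i})"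
      by (rule emeasure_PiM) auto
    also have "\<dots> = ennreal (\<Prod>i\<in>UNIV. u $ i - l $ i)"
      using lu by (simp add: prod_ennreal)
    also have "(\<Prod>i\<in>UNIV. u $ i - l $ i) = (\<Prod>b\<in>Basis. (u - l) \<bullet> b)"
    proof -
      have B: "(Basis :: (real^'n) set) = (\<lambda>i. axis i 1) ` UNIV" by (auto simp: Basis_vec_def)
      have "inj (\<lambda>i::'n. axis i (1::real))" by (auto simp: inj_def axis_eq_axis)
      then show ?thesis unfolding B by (simp add: prod.reindex inner_axis)
    qed
    finally show "emeasure (distr (coord_lborel UNIV) borel (\<lambda>t. \<chi> i::'n. t i)) (box l u)
      = ennreal (\<Prod>b\<in>Basis. (u - l) \<bullet> b)" .
  qed simp
  then have "(\<integral>\<^sup>+t. g t \<partial>lborel) = (\<integral>\<^sup>+t. g t \<partial>distr (coord_lborel UNIV) borel (\<lambda>t. \<chi> i::'n. t i))"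
    by simp
  also have "\<dots> = (\<integral>\<^sup>+t. g (\<chi> i. t i) \<partial>coord_lborel UNIV)"
    using g by (simp add: nn_integral_distr[OF meas])
  finally show ?thesis .
qed

lemma measurable_vec_lambda:
  "(\<lambda>x. \<chi> i. x i) \<in> fun_borel \<rightarrow>\<^sub>M (borel :: (real^'n::finite) measure)"
  by (subst borel_measurable_euclidean_space) (auto simp: Basis_vec_def inner_axis)

text \<open>Each \<open>cosh\<close> is the average of a ratio of exponentials and its inverse. As
  \<open>W\<close> is symmetric, both halves have the same double sum, which is that of
  \<open>energy\<close>. The tree sum is handled by the matrix-tree theorem.\<close>

lemma t_field_density_eq_weight:
  fixes W :: "'n::finite option \<Rightarrow> 'n option \<Rightarrow> real"
  assumes sym: "\<And>i j. W i j = W j i"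
  shows "t_field_density W t = weight UNIV W (\<lambda>i. exp (t $ i))"
proof -
  let ?x = "\<lambda>i. exp (t $ i)"
  have V: "pin_set (UNIV :: 'n set) = UNIV" by (simp add: pin_set_def UNIV_option_conv)
  have X: "exp (pinned t u) = pin_ext ?x u" for u by (cases u) (auto simp: pinned_def)
  have "(\<Sum>i\<in>UNIV. \<Sum>j\<in>UNIV. W i j * (cosh (pinned t i - pinned t j) - 1))
    = (\<Sum>i\<in>UNIV. \<Sum>j\<in>UNIV. W i j * (pin_ext ?x i / pin_ext ?x j - 1))"
  proof -
    let ?f = "\<lambda>i j. W i j * (pin_ext ?x i / pin_ext ?x j - 1)"
    have e: "W i j * (cosh (pinned t i - pinned t j) - 1) = (?f i j + ?f j i) / 2" for i j
    proof -
      have c: "cosh (pinned t i - pinned t j) = (pin_ext ?x i / pin_ext ?x j + pin_ext ?x j / pin_ext ?x i) / 2"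
        unfolding cosh_def X[symmetric] by (simp add: exp_diff)
      have s: "W j i = W i j" by (rule sym)
      show ?thesis unfolding c s by (simp add: algebra_simps add_divide_distrib diff_divide_distrib)
    qed
    have "(\<Sum>i\<in>UNIV. \<Sum>j\<in>UNIV. W i j * (cosh (pinned t i - pinned t j) - 1))
       = ((\<Sum>i\<in>UNIV. \<Sum>j\<in>UNIV. ?f i j) + (\<Sum>i\<in>UNIV. \<Sum>j\<in>UNIV. ?f j i)) / 2"
      by (simp only: e sum.distrib flip: sum_divide_distrib)
    also have "(\<Sum>i\<in>UNIV. \<Sum>j\<in>UNIV. ?f j i) = (\<Sum>i\<in>UNIV. \<Sum>j\<in>UNIV. ?f i j)"
      by (rule sum.swap)
    finally show ?thesis by simp
  qed
  then have "exp (- (1 / 2) * (\<Sum>i\<in>UNIV. \<Sum>j\<in>UNIV. W i j * (cosh (pinned t i - pinned t j) - 1)))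
      = exp (- energy UNIV W ?x)"
    by (simp add: energy_def V)
  moreover have "tree_sum W t = det (sub_laplacian UNIV W ?x)"
  proof -
    have "laplacian (\<lambda>i j. W i j * exp (pinned t i + pinned t j)) = sub_laplacian UNIV W ?x"
      by (auto simp: laplacian_def sub_laplacian_def vec_eq_iff V exp_add X sum_distrib_left mult_ac intro!: sum.cong)
    then show ?thesis using tree_sum_eq_det[of W t, OF sym] by simp
  qed
  moreover have "(\<Prod>i\<in>UNIV. exp (- (t $ i)) / sqrt (2 * pi)) = (\<Prod>i\<in>UNIV. 1 / (?x i * sqrt (2 * pi)))"
    by (simp add: exp_minus inverse_eq_divide)
  ultimately show ?thesis by (simp add: t_field_density_def weight_def)
qed

lemma measurable_exp_vec: "(\<lambda>t i. exp (t $ i)) \<in> (borel :: (real^'n::finite) measure) \<rightarrow>\<^sub>M fun_borel"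
  by (rule measurable_fun_borelI) auto

lemma borel_measurable_t_field_density:
  fixes W :: "'n::finite option \<Rightarrow> 'n option \<Rightarrow> real"
  assumes sym: "\<And>i j. W i j = W j i"
  shows "t_field_density W \<in> borel_measurable borel"
  using measurable_compose[OF measurable_exp_vec borel_measurable_weight_fun_borel, of UNIV W]
  by (simp add: t_field_density_eq_weight[of W, OF sym, abs_def])

lemma nn_integral_t_field:
  fixes W :: "'n::finite option \<Rightarrow> 'n option \<Rightarrow> real"
  assumes sym: "\<And>i j. W i j = W j i" and f: "f \<in> borel_measurable fun_borel"
  shows "(\<integral>\<^sup>+t. f (\<lambda>i. exp (t $ i)) \<partial>t_field W) = field_int UNIV W f"
proof -
  have [measurable]: "t_field_density W \<in> borel_measurable borel"
    by (rule borel_measurable_t_field_density[of W, OF sym])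
  have [measurable]: "(\<lambda>t :: real^'n. f (\<lambda>i. exp (t $ i))) \<in> borel_measurable borel"
    by (rule measurable_compose[OF measurable_exp_vec f])
  have "(\<integral>\<^sup>+t. f (\<lambda>i. exp (t $ i)) \<partial>t_field W)
      = (\<integral>\<^sup>+t. ennreal (t_field_density W t) * f (\<lambda>i. exp (t $ i)) \<partial>lborel)"
    unfolding t_field_def by (rule nn_integral_density) auto
  also have "\<dots> = field_int UNIV W f"
  proof -
    have "(\<lambda>t. ennreal (t_field_density W t) * f (\<lambda>i. exp (t $ i))) \<in> borel_measurable borel"
      by measurable
    from nn_integral_lborel_vec[OF this] show ?thesis
      by (simp add: field_int_def t_field_density_eq_weight[of W, OF sym] mult.commute)
  qed
  finally show ?thesis .
qed

section \<open>Affine minorants and extended integrals\<close>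

lemma convex_affine_minorant:
  fixes F :: "real^'n::finite \<Rightarrow> real"
  assumes conv: "convex_on UNIV F" and diff: "F differentiable at 0"
  obtains c g where "\<And>x. c + (\<Sum>i\<in>UNIV. g i * x $ i) \<le> F x"
proof -
  obtain D where D: "(F has_derivative D) (at 0)" using diff by (auto simp: differentiable_def)
  then have lin: "linear D" by (rule has_derivative_linear)
  have "F 0 + D x \<le> F x" for x
  proof -
    \<comment> \<open>The minorant is the tangent at the origin; restricting \<open>F\<close> to the
      line through \<open>x\<close> reduces the inequality to one variable.\<close>
    have c: "convex_on UNIV (\<lambda>s. F (s *\<^sub>R x))"
    proof (rule convex_onI)
      fix u a b :: real assume "0 < u" "u < 1"
      then have "F ((1 - u) *\<^sub>R (a *\<^sub>R x) + u *\<^sub>R (b *\<^sub>R x)) \<le> (1 - u) * F (a *\<^sub>R x) + u * F (b *\<^sub>R x)"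
        by (intro convex_onD[OF conv]) auto
      then show "F (((1 - u) *\<^sub>R a + u *\<^sub>R b) *\<^sub>R x) \<le> (1 - u) * F (a *\<^sub>R x) + u * F (b *\<^sub>R x)"
        by (simp add: scaleR_add_left)
    qed simp
    have d: "((\<lambda>s. F (s *\<^sub>R x)) has_field_derivative D x) (at 0)"
    proof -
      have "((\<lambda>s. s *\<^sub>R x) has_derivative (\<lambda>s. s *\<^sub>R x)) (at 0)"
        by (rule bounded_linear_imp_has_derivative) (rule bounded_linear_scaleR_left)
      from has_derivative_compose[OF this, of F D] D
      have "((\<lambda>s. F (s *\<^sub>R x)) has_derivative (\<lambda>s. D (s *\<^sub>R x))) (at 0)" by simp
      moreover have "(\<lambda>s. D (s *\<^sub>R x)) = (*) (D x)"
        by (auto simp: linear_cmul[OF lin])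
      ultimately show ?thesis by (simp add: has_field_derivative_def)
    qed
    have "D x * (1 - 0) \<le> F (1 *\<^sub>R x) - F (0 *\<^sub>R x)"
      by (rule convex_on_imp_above_tangent[OF c _ _ _ d]) simp_all
    then show ?thesis by simp
  qed
  moreover have "D x = (\<Sum>i\<in>UNIV. D (axis i 1) * x $ i)" for x
  proof -
    have "D x = D (\<Sum>i\<in>UNIV. x $ i *\<^sub>R axis i 1)"
      using basis_expansion[of x] by (simp add: scalar_mult_eq_scaleR)
    also have "\<dots> = (\<Sum>i\<in>UNIV. D (axis i 1) * x $ i)"
      by (simp add: linear_sum[OF lin] linear_cmul[OF lin] mult.commute)
    finally show ?thesis .
  qed
  ultimately have "F 0 + (\<Sum>i\<in>UNIV. D (axis i 1) * x $ i) \<le> F x" for x by metis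
  then show ?thesis by (rule that)
qed

lemma extended_integral_integrable:
  assumes "integrable M f"
  shows "extended_integral M f = ereal (integral\<^sup>L M f)"
proof -
  have "(\<integral>\<^sup>+x. ennreal (f x) \<partial>M) \<noteq> \<infinity>" "(\<integral>\<^sup>+x. ennreal (- f x) \<partial>M) \<noteq> \<infinity>"
    using assms by (auto simp: real_integrable_def)
  then show ?thesis
    unfolding extended_integral_def real_lebesgue_integral_def[OF assms]
    by (cases "\<integral>\<^sup>+x. ennreal (f x) \<partial>M"; cases "\<integral>\<^sup>+x. ennreal (- f x) \<partial>M") auto
qed

text \<open>If \<open>h\<close> has infinite integral, bounding it by the positive part of
  \<open>h + l\<close> plus the negative part of \<open>l\<close> makes the former infinite. The
  negative part of \<open>h + l\<close> is at most that of \<open>l\<close>, so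
  \<open>\<infinity> - \<infinity>\<close> does not occur.\<close>

lemma extended_integral_add_integrable:
  assumes h [measurable]: "h \<in> borel_measurable M" and h_nonneg: "\<And>x. 0 \<le> h x" and l: "integrable M l"
  shows "extended_integral M (\<lambda>x. h x + l x) = enn2ereal (\<integral>\<^sup>+x. ennreal (h x) \<partial>M) + ereal (integral\<^sup>L M l)"
proof (cases "(\<integral>\<^sup>+x. ennreal (h x) \<partial>M) = \<infinity>")
  case False
  then have int: "integrable M h"
    using h_nonneg by (intro integrableI_nonneg) (auto simp: less_top)
  then have "(\<integral>\<^sup>+x. ennreal (h x) \<partial>M) = ennreal (integral\<^sup>L M h)"
    using h_nonneg by (intro nn_integral_eq_integral) auto
  moreover have "extended_integral M (\<lambda>x. h x + l x) = ereal (integral\<^sup>L M h + integral\<^sup>L M l)"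
    using int l by (subst extended_integral_integrable) auto
  ultimately show ?thesis using h_nonneg by (simp add: integral_nonneg enn2ereal_ennreal)
next
  case True
  have [measurable]: "l \<in> borel_measurable M" using l by auto
  have fin: "(\<integral>\<^sup>+x. ennreal (- l x) \<partial>M) < \<infinity>"
    using l by (auto simp: real_integrable_def less_top)
  have "\<infinity> \<le> (\<integral>\<^sup>+x. ennreal (h x + l x) + ennreal (- l x) \<partial>M)"
    unfolding True[symmetric]
  proof (rule nn_integral_mono)
    fix x
    have "ennreal (h x) \<le> ennreal (max 0 (h x + l x) + max 0 (- l x))"
      by (rule ennreal_leI) simp
    also have "\<dots> = ennreal (h x + l x) + ennreal (- l x)"
      by (subst ennreal_plus) (simp_all add: max_def ennreal_neg)
    finally show "ennreal (h x) \<le> ennreal (h x + l x) + ennreal (- l x)" .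
  qed
  also have "\<dots> = (\<integral>\<^sup>+x. ennreal (h x + l x) \<partial>M) + (\<integral>\<^sup>+x. ennreal (- l x) \<partial>M)"
    by (rule nn_integral_add) auto
  finally have top: "(\<integral>\<^sup>+x. ennreal (h x + l x) \<partial>M) = \<infinity>"
    using fin by (auto simp: top_unique)
  have "(\<integral>\<^sup>+x. ennreal (- (h x + l x)) \<partial>M) \<le> (\<integral>\<^sup>+x. ennreal (- l x) \<partial>M)"
    using h_nonneg by (intro nn_integral_mono ennreal_leI) simp
  with fin have "(\<integral>\<^sup>+x. ennreal (- (h x + l x)) \<partial>M) \<noteq> \<infinity>" by (auto simp: top_unique)
  then show ?thesis unfolding extended_integral_def True top
    by (cases "\<integral>\<^sup>+x. ennreal (- (h x + l x)) \<partial>M") auto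
qed

lemma t_field_mass_mean:
  fixes W :: "'n::finite option \<Rightarrow> 'n option \<Rightarrow> real"
  assumes sym: "\<And>i j. W i j = W j i" and W: "pos_weights UNIV W"
  shows "emeasure (t_field W) (space (t_field W)) = 1" "(\<integral>\<^sup>+t. ennreal (exp (t $ k)) \<partial>t_field W) = 1"
proof -
  have m: "field_int UNIV W (\<lambda>_. 1) = 1 \<and> field_int UNIV W (\<lambda>x. ennreal (x k)) = 1"
    using field_int_mass_mean[of k "UNIV - {k}" W] W by (simp add: insert_Diff_if)
  then show "emeasure (t_field W) (space (t_field W)) = 1"
    using nn_integral_t_field[of W "\<lambda>_. 1", OF sym] by simp
  have "(\<lambda>x. ennreal (x k)) \<in> borel_measurable fun_borel" by measurable
  then show "(\<integral>\<^sup>+t. ennreal (exp (t $ k)) \<partial>t_field W) = 1"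
    using m nn_integral_t_field[of W "\<lambda>x. ennreal (x k)", OF sym] by simp
qed

text \<open>Splitting off the affine minorant leaves a nonnegative integrand, to which the results
  on \<open>field_int\<close> apply. Mass and means 1 give the affine part the value
  \<open>c + (\<Sum>i\<in>UNIV. g i)\<close> for all weights.\<close>

lemma J_integral_eq:
  fixes W :: "'n::finite option \<Rightarrow> 'n option \<Rightarrow> real" and F :: "real^'n \<Rightarrow> real"
  assumes sym: "\<And>i j. W i j = W j i" and W: "pos_weights UNIV W"
    and F: "F \<in> borel_measurable borel" and minorant: "\<And>x. c + (\<Sum>i\<in>UNIV. g i * x $ i) \<le> F x"
  shows "J_integral W F = enn2ereal (field_int UNIV W
      (\<lambda>x. ennreal (F (\<chi> i. x i) - (c + (\<Sum>i\<in>UNIV. g i * x i))))) + ereal (c + (\<Sum>i\<in>UNIV. g i))"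
proof -
  let ?h = "\<lambda>x. F (\<chi> i. x i) - (c + (\<Sum>i\<in>UNIV. g i * x i))"
  let ?l = "\<lambda>t :: real^'n. c + (\<Sum>i\<in>UNIV. g i * exp (t $ i))"
  interpret prob_space "t_field W"
    by standard (rule t_field_mass_mean(1)[of W, OF sym W])
  have sets [measurable_cong]: "sets (t_field W) = sets borel" by (simp add: t_field_def)
  have exp_meas: "(\<lambda>t. exp (t $ k)) \<in> borel_measurable (t_field W)" for k
  proof -
    have "(\<lambda>t :: real^'n. exp (t $ k)) \<in> borel_measurable borel"
      by (intro borel_measurable_continuous_onI continuous_intros)
    then show ?thesis using sets by (simp cong: measurable_cong_sets)
  qed
  have exp_int: "integrable (t_field W) (\<lambda>t. exp (t $ k))" for k
    using t_field_mass_mean(2)[of W k, OF sym W] by (intro integrableI_nonneg[OF exp_meas]) auto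
  have exp_mean: "(LINT t|t_field W. exp (t $ k)) = 1" for k
    using t_field_mass_mean(2)[of W k, OF sym W] by (subst integral_eq_nn_integral[OF exp_meas]) auto
  have [measurable]: "(\<lambda>x. F (\<chi> i. x i)) \<in> borel_measurable fun_borel"
    by (rule measurable_compose[OF measurable_vec_lambda F])
  have h: "?h \<in> borel_measurable fun_borel" by measurable
  have "J_integral W F = extended_integral (t_field W) (\<lambda>t. ?h (\<lambda>i. exp (t $ i)) + ?l t)"
    by (simp add: J_integral_def)
  also have "\<dots> = enn2ereal (\<integral>\<^sup>+t. ennreal (?h (\<lambda>i. exp (t $ i))) \<partial>t_field W) + ereal (LINT t|t_field W. ?l t)"
  proof (rule extended_integral_add_integrable)
    show "(\<lambda>t. ?h (\<lambda>i. exp (t $ i))) \<in> borel_measurable (t_field W)"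
      using measurable_compose[OF measurable_exp_vec h] sets by (simp cong: measurable_cong_sets)
    show "0 \<le> ?h (\<lambda>i. exp (t $ i))" for t :: "real^'n"
      using minorant[of "\<chi> i. exp (t $ i)"] by simp
    show "integrable (t_field W) ?l" using exp_int by auto
  qed
  also have "(LINT t|t_field W. ?l t) = c + (\<Sum>i\<in>UNIV. g i)"
    using exp_int by (simp add: exp_mean prob_space)
  also have "(\<integral>\<^sup>+t. ennreal (?h (\<lambda>i. exp (t $ i))) \<partial>t_field W) = field_int UNIV W (\<lambda>x. ennreal (?h x))"
    using h by (intro nn_integral_t_field[of W, OF sym]) measurable
  finally show ?thesis .
qed

theorem theorem1:
  fixes W :: "'n::finite option \<Rightarrow> 'n option \<Rightarrow> real"
    and F :: "real ^ 'n \<Rightarrow> real"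
  assumes W_sym: "\<And>i j. W i j = W j i"
    and W_pos: "\<And>i j. i \<noteq> j \<Longrightarrow> 0 < W i j"
    and F_smooth: "smooth F"
    and F_convex: "convex_on UNIV F"
  shows "\<forall>i j. i \<noteq> j \<longrightarrow> antimono_on {0<..} (\<lambda>w. J_integral (set_weight W i j w) F)"
proof (intro allI impI)
  fix i j :: "'n option"
  assume ij: "i \<noteq> j"
  have "times_cont_differentiable 0 F" "times_cont_differentiable (Suc 0) F"
    using F_smooth unfolding smooth_def by blast+
  then have cont: "continuous_on UNIV F" and diff: "F differentiable at 0" by auto
  have F: "F \<in> borel_measurable borel" using cont by (rule borel_measurable_continuous_onI)
  obtain c g where minorant: "\<And>x. c + (\<Sum>i\<in>UNIV. g i * x $ i) \<le> F x"
    using convex_affine_minorant[OF F_convex diff] by blast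
  define h where "h x = F (\<chi> i. x i) - (c + (\<Sum>i\<in>UNIV. g i * x i))" for x
  have W: "pos_weights UNIV W"
    using W_sym W_pos by (auto simp: pos_weights_def symmetric_weights_def)
  have h: "convex_test h"
    unfolding convex_test_def
  proof (intro conjI allI impI)
    have [measurable]: "(\<lambda>x. F (\<chi> i. x i)) \<in> borel_measurable fun_borel"
      by (rule measurable_compose[OF measurable_vec_lambda F])
    show "h \<in> borel_measurable fun_borel" unfolding h_def by measurable
    show "0 \<le> h x" for x using minorant[of "\<chi> i. x i"] by (simp add: h_def)
    fix x y :: "'n \<Rightarrow> real" and u :: real assume u: "0 \<le> u" "u \<le> 1"
    have "F ((1 - u) *\<^sub>R (\<chi> i. x i) + u *\<^sub>R (\<chi> i. y i)) \<le> (1 - u) * F (\<chi> i. x i) + u * F (\<chi> i. y i)"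
      using u by (intro convex_onD[OF F_convex]) auto
    moreover have "(1 - u) *\<^sub>R (\<chi> i. x i) + u *\<^sub>R (\<chi> i. y i) = (\<chi> i. (1 - u) * x i + u * y i)"
      by (simp add: vec_eq_iff)
    moreover have "(\<Sum>i\<in>UNIV. g i * ((1 - u) * x i + u * y i))
       = (1 - u) * (\<Sum>i\<in>UNIV. g i * x i) + u * (\<Sum>i\<in>UNIV. g i * y i)"
      by (simp add: distrib_left sum.distrib sum_distrib_left mult_ac)
    ultimately show "h (\<lambda>i. (1 - u) * x i + u * y i) \<le> (1 - u) * h x + u * h y"
      unfolding h_def by (simp add: algebra_simps)
  qed
  show "antimono_on {0<..} (\<lambda>w. J_integral (set_weight W i j w) F)"
  proof (rule monotone_onI)
    fix w w' :: real
    assume w: "w \<in> {0<..}" "w' \<in> {0<..}" "w \<le> w'"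
    have J: "J_integral (set_weight W i j z) F
        = enn2ereal (field_int UNIV (set_weight W i j z) (\<lambda>x. ennreal (h x))) + ereal (c + (\<Sum>i\<in>UNIV. g i))"
      if "0 < z" for z
      unfolding h_def
    proof (rule J_integral_eq[OF _ pos_weights_set_weight[OF W that] F minorant])
      show "set_weight W i j z a b = set_weight W i j z b a" for a b
        using W_sym[of a b] by (simp add: set_weight_def insert_commute)
    qed
    have "field_int UNIV (set_weight W i j w') (\<lambda>x. ennreal (h x))
       \<le> field_int UNIV (set_weight W i j w) (\<lambda>x. ennreal (h x))"
      using w by (intro field_int_antimono[OF W h ij]) auto
    then show "J_integral (set_weight W i j w) F \<ge> J_integral (set_weight W i j w') F"
      using w by (simp add: J add_right_mono less_eq_ennreal.rep_eq)
  qed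
qed

end
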